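(* Let $0<\lambda\le\Lambda$. There exist constants $C>1$ and $\eta>1$, depending only on $\lambda$ and $\Lambda$, such that the following holds for every operator $L=a_{11}X_1^2+2a_{12}X_2X_1+a_{22}X_2^2$ with ellipticity constants $\lambda,\Lambda$, every $y\in\mathbb{R}^2$ and every $r>0$: if $u\in C^2(B(y,\eta r))\cap C(\overline{B(y,\eta r)})$ satisfies $Lu=0$ and $u\ge 0$ in $B(y,\eta r)$, then $$\sup_{B(y,r)}u\le C\inf_{B(y,r)}u .$$
   Context: On $\mathbb{R}^2$ with points $x=(x_1,x_2)$, let $X_1=\partial_{x_1}$ and $X_2=x_1\partial_{x_2}$ (Grushin vector fields). The operator is $L=a_{11}X_1^2+2a_{12}X_2X_1+a_{22}X_2^2$, i.e. $Lu=a_{11}u_{x_1x_1}+2a_{12}X_2X_1u+a_{22}X_2^2u$ with $X_2X_1u=x_1u_{x_1x_2}$ and $X_2^2u=x_1^2u_{x_2x_2}$, where $a_{11},a_{12},a_{22}$ are measurable real functions on $\mathbb{R}^2$ such that at every point $\lambda(\xi_1^2+\xi_2^2)\le a_{11}\xi_1^2+2a_{12}\xi_1\xi_2+a_{22}\xi_2^2\le\Lambda(\xi_1^2+\xi_2^2)$ for all $\xi\in\mathbb{R}^2$; then $\lambda,\Lambda$ are called ellipticity constants of $L$. For $x,y\in\mathbb{R}^2$ put $\tilde d(x,y)=|x_1-y_1|+\sqrt{x_1^2+y_1^2+4|x_2-y_2|}-\sqrt{x_1^2+y_1^2}$, and let $B(y,r)=\{x\in\mathbb{R}^2:\tilde d(x,y)<r\}$.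 *)

theory Defs
  imports "HOL-Analysis.Analysis"
begin

definition partial1 :: "(real \<times> real \<Rightarrow> real) \<Rightarrow> real \<times> real \<Rightarrow> real" where
  "partial1 u x = deriv (\<lambda>t. u (t, snd x)) (fst x)"

definition partial2 :: "(real \<times> real \<Rightarrow> real) \<Rightarrow> real \<times> real \<Rightarrow> real" where
  "partial2 u x = deriv (\<lambda>t. u (fst x, t)) (snd x)"

text \<open>
  The following two predicates are meant for open sets \<open>S\<close>; there they do not depend on the
  values of \<open>u\<close> outside \<open>S\<close>. Differentiability is required explicitly, since
  \<^const>\<open>deriv\<close> is a total function.
\<close>

definition C1_on :: "(real \<times> real) set \<Rightarrow> (real \<times> real \<Rightarrow> real) \<Rightarrow> bool" where
  "C1_on S u \<longleftrightarrow>
     (\<forall>x\<in>S. (\<lambda>t. u (t, snd x)) field_differentiable at (fst x) \<and>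
             (\<lambda>t. u (fst x, t)) field_differentiable at (snd x)) \<and>
     continuous_on S (partial1 u) \<and> continuous_on S (partial2 u)"

definition C2_on :: "(real \<times> real) set \<Rightarrow> (real \<times> real \<Rightarrow> real) \<Rightarrow> bool" where
  "C2_on S u \<longleftrightarrow> C1_on S u \<and> C1_on S (partial1 u) \<and> C1_on S (partial2 u)"

definition grushin_X1 :: "(real \<times> real \<Rightarrow> real) \<Rightarrow> real \<times> real \<Rightarrow> real" where
  "grushin_X1 u x = partial1 u x"

definition grushin_X2 :: "(real \<times> real \<Rightarrow> real) \<Rightarrow> real \<times> real \<Rightarrow> real" where
  "grushin_X2 u x = fst x * partial2 u x"

definition grushin_L ::
  "(real \<times> real \<Rightarrow> real) \<Rightarrow> (real \<times> real \<Rightarrow> real) \<Rightarrow> (real \<times> real \<Rightarrow> real) \<Rightarrow>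
   (real \<times> real \<Rightarrow> real) \<Rightarrow> real \<times> real \<Rightarrow> real" where
  "grushin_L a11 a12 a22 u x =
     a11 x * grushin_X1 (grushin_X1 u) x
     + 2 * a12 x * grushin_X2 (grushin_X1 u) x
     + a22 x * grushin_X2 (grushin_X2 u) x"

definition ellipticity_constants ::
  "real \<Rightarrow> real \<Rightarrow> (real \<times> real \<Rightarrow> real) \<Rightarrow> (real \<times> real \<Rightarrow> real) \<Rightarrow>
   (real \<times> real \<Rightarrow> real) \<Rightarrow> bool" where
  "ellipticity_constants lam Lam a11 a12 a22 \<longleftrightarrow>
     (\<forall>x \<xi>1 \<xi>2.
        lam * (\<xi>1\<^sup>2 + \<xi>2\<^sup>2) \<le> a11 x * \<xi>1\<^sup>2 + 2 * a12 x * \<xi>1 * \<xi>2 + a22 x * \<xi>2\<^sup>2 \<and>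
        a11 x * \<xi>1\<^sup>2 + 2 * a12 x * \<xi>1 * \<xi>2 + a22 x * \<xi>2\<^sup>2 \<le> Lam * (\<xi>1\<^sup>2 + \<xi>2\<^sup>2))"

definition grushin_dist :: "real \<times> real \<Rightarrow> real \<times> real \<Rightarrow> real" where
  "grushin_dist x y =
     \<bar>fst x - fst y\<bar>
     + sqrt ((fst x)\<^sup>2 + (fst y)\<^sup>2 + 4 * \<bar>snd x - snd y\<bar>)
     - sqrt ((fst x)\<^sup>2 + (fst y)\<^sup>2)"

definition grushin_ball :: "real \<times> real \<Rightarrow> real \<Rightarrow> (real \<times> real) set" where
  "grushin_ball y r = {x. grushin_dist x y < r}"

end

theory Submission
  imports Defs
begin

text \<open>
  The proof uses Serrin's two-dimensional argument in place of an Aleksandrov--Bakelman--Pucci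
  estimate. Put \<open>\<sigma> = \<bar>y\<^sub>1\<bar> + r\<close>. The dilation \<open>x = (y\<^sub>1 + r t, y\<^sub>2 + r \<sigma> s)\<close> turns the Grushin fields
  into \<open>\<partial>\<^sub>t\<close> and \<open>h(t) \<partial>\<^sub>s\<close> with \<open>h(t) = \<beta> + \<gamma> t\<close>, \<open>\<gamma> \<ge> 0\<close> and \<open>\<bar>\<beta>\<bar> + \<gamma> = 1\<close>, so that all centres and radii
  are covered by one compact family of operators on a fixed box.

  If \<open>u z > 0\<close> at a point \<open>z\<close> of the unit square, the maximum principle gives a path in
  \<open>{u > u z / 2}\<close> from \<open>z\<close> to the boundary of \<open>[-5,5] \<times> [-3,3]\<close>, and this path crosses a strip away
  from \<open>z\<close>. Take a function \<open>v = k (exp (- \<alpha> \<rho>) - exp (- \<alpha> c))\<close> with \<open>\<rho>\<close> a weighted squared distance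
  from a pole beyond one end of the strip and \<open>{v > 0}\<close> inside the strip. Where \<open>v > u\<close>, the maximum
  principle gives a second path, along which \<open>v > u\<close>, running lengthwise through the strip towards the
  pole; by the Fashoda theorem it would have to meet the first one, which is impossible as
  \<open>v < k = u z / 2\<close>. Hence \<open>u \<ge> v\<close> on a small square. Such a \<open>v\<close> is a strict subsolution for every
  operator of the class as long as no critical point of \<open>\<rho>\<close> in \<open>t\<close> lies on the line \<open>h = 0\<close>, which
  can be arranged by choosing between two strips. A last radial function centred in the small
  square carries the lower bound to the whole unit square.
\<close>

subsection \<open>The maximum principle\<close>

text \<open>
  Only second derivatives along lines enter the maximum principle, and these are transported
  trivially by affine changes of variables.
\<close>

definition second_along :: "('a::real_normed_vector \<Rightarrow> real) \<Rightarrow> 'a \<Rightarrow> 'a \<Rightarrow> real \<Rightarrow> bool" where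
  "second_along w x \<xi> D \<longleftrightarrow>
     (\<exists>w'. (\<forall>\<^sub>F \<tau> in nhds 0. ((\<lambda>\<tau>. w (x + \<tau> *\<^sub>R \<xi>)) has_real_derivative w' \<tau>) (at \<tau>)) \<and>
           (w' has_real_derivative D) (at 0))"

lemma second_along_add:
  assumes "second_along v x \<xi> D" "second_along w x \<xi> E"
  shows "second_along (\<lambda>x. v x + w x) x \<xi> (D + E)"
proof -
  obtain v' w' where e:
    "\<forall>\<^sub>F \<tau> in nhds 0. ((\<lambda>\<tau>. v (x + \<tau> *\<^sub>R \<xi>)) has_real_derivative v' \<tau>) (at \<tau>)"
    "\<forall>\<^sub>F \<tau> in nhds 0. ((\<lambda>\<tau>. w (x + \<tau> *\<^sub>R \<xi>)) has_real_derivative w' \<tau>) (at \<tau>)"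
    and d: "(v' has_real_derivative D) (at 0)" "(w' has_real_derivative E) (at 0)"
    using assms unfolding second_along_def by blast
  from e have "\<forall>\<^sub>F \<tau> in nhds 0. ((\<lambda>\<tau>. v (x + \<tau> *\<^sub>R \<xi>) + w (x + \<tau> *\<^sub>R \<xi>))
      has_real_derivative v' \<tau> + w' \<tau>) (at \<tau>)"
    by eventually_elim (rule DERIV_add)
  with DERIV_add[OF d] show ?thesis
    unfolding second_along_def by (intro exI[of _ "\<lambda>\<tau>. v' \<tau> + w' \<tau>"]) simp
qed

lemma second_along_minus:
  assumes "second_along v x \<xi> D"
  shows "second_along (\<lambda>x. - v x) x \<xi> (- D)"
proof -
  obtain v' where e:
    "\<forall>\<^sub>F \<tau> in nhds 0. ((\<lambda>\<tau>. v (x + \<tau> *\<^sub>R \<xi>)) has_real_derivative v' \<tau>) (at \<tau>)"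
    and d: "(v' has_real_derivative D) (at 0)"
    using assms unfolding second_along_def by blast
  from e have "\<forall>\<^sub>F \<tau> in nhds 0. ((\<lambda>\<tau>. - v (x + \<tau> *\<^sub>R \<xi>)) has_real_derivative - v' \<tau>) (at \<tau>)"
    by eventually_elim (rule DERIV_minus)
  with DERIV_minus[OF d] show ?thesis
    unfolding second_along_def by (intro exI[of _ "\<lambda>\<tau>. - v' \<tau>"]) simp
qed

text \<open>At a maximum the first derivative along the line vanishes. If \<open>D\<close> were
  positive, that derivative would be positive just after 0, and the mean value theorem would yield a
  larger value.\<close>

lemma second_along_local_max:
  assumes D: "second_along w x \<xi> D" and max: "\<forall>\<^sub>F z in nhds x. w z \<le> w x"
  shows "D \<le> 0"
proof (rule ccontr)
  assume "\<not> D \<le> 0"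
  then have "0 < D" by simp
  obtain w' where w': "\<forall>\<^sub>F \<tau> in nhds 0. ((\<lambda>\<tau>. w (x + \<tau> *\<^sub>R \<xi>)) has_real_derivative w' \<tau>) (at \<tau>)"
    and d: "(w' has_real_derivative D) (at 0)"
    using D unfolding second_along_def by blast
  have "filterlim (\<lambda>\<tau>. x + \<tau> *\<^sub>R \<xi>) (nhds (x + 0 *\<^sub>R \<xi>)) (nhds 0)"
    by (intro tendsto_intros filterlim_ident)
  then have "\<forall>\<^sub>F \<tau> in nhds 0. w (x + \<tau> *\<^sub>R \<xi>) \<le> w x"
    using eventually_compose_filterlim[OF max] by simp
  with w' have "\<forall>\<^sub>F \<tau> in nhds 0. ((\<lambda>\<tau>. w (x + \<tau> *\<^sub>R \<xi>)) has_real_derivative w' \<tau>) (at \<tau>)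
      \<and> w (x + \<tau> *\<^sub>R \<xi>) \<le> w x"
    by eventually_elim simp
  then obtain d1 where d1: "d1 > 0"
    and h: "\<And>\<tau>. \<bar>\<tau>\<bar> < d1 \<Longrightarrow> ((\<lambda>\<tau>. w (x + \<tau> *\<^sub>R \<xi>)) has_real_derivative w' \<tau>) (at \<tau>)"
    and m: "\<And>\<tau>. \<bar>\<tau>\<bar> < d1 \<Longrightarrow> w (x + \<tau> *\<^sub>R \<xi>) \<le> w x"
    by (auto simp: eventually_nhds_metric dist_real_def)
  have w0: "w' 0 = 0"
    using DERIV_local_max[OF h[of 0] d1] m d1 by auto
  obtain d2 where d2: "d2 > 0" "\<And>\<tau>. 0 < \<tau> \<Longrightarrow> \<tau> < d2 \<Longrightarrow> 0 < w' \<tau>"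
    using DERIV_pos_inc_right[OF d \<open>0 < D\<close>] w0 by auto
  define t where "t = min d1 d2 / 2"
  have t: "0 < t" "t < d1" "t < d2" using d1 d2 by (auto simp: t_def)
  obtain s where s: "0 < s" "s < t" "w (x + t *\<^sub>R \<xi>) - w (x + 0 *\<^sub>R \<xi>) = (t - 0) * w' s"
    using MVT2[of 0 t "\<lambda>\<tau>. w (x + \<tau> *\<^sub>R \<xi>)" w'] h t by auto
  have "0 < t * w' s" using s t d2 by simp
  with s m[of t] t show False by simp
qed

section \<open>Ellipticity and strict subsolutions\<close>

definition elliptic :: "real \<Rightarrow> real \<Rightarrow> real \<Rightarrow> real \<Rightarrow> real \<Rightarrow> bool" where
  "elliptic lam Lam a b c \<longleftrightarrow>
     (\<forall>\<xi> \<eta>. lam * (\<xi>\<^sup>2 + \<eta>\<^sup>2) \<le> a * \<xi>\<^sup>2 + 2 * b * \<xi> * \<eta> + c * \<eta>\<^sup>2 \<and>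
            a * \<xi>\<^sup>2 + 2 * b * \<xi> * \<eta> + c * \<eta>\<^sup>2 \<le> Lam * (\<xi>\<^sup>2 + \<eta>\<^sup>2))"

lemma ellipticD:
  assumes "elliptic lam Lam a b c"
  shows "lam * (\<xi>\<^sup>2 + \<eta>\<^sup>2) \<le> a * \<xi>\<^sup>2 + 2 * b * \<xi> * \<eta> + c * \<eta>\<^sup>2"
    "lam \<le> a" "a \<le> Lam" "lam \<le> c" "c \<le> Lam"
proof -
  show "lam * (\<xi>\<^sup>2 + \<eta>\<^sup>2) \<le> a * \<xi>\<^sup>2 + 2 * b * \<xi> * \<eta> + c * \<eta>\<^sup>2"
    using assms by (auto simp: elliptic_def)
  show "lam \<le> a" "a \<le> Lam" "lam \<le> c" "c \<le> Lam"
    using assms[unfolded elliptic_def, rule_format, of 1 0] assms[unfolded elliptic_def, rule_format, of 0 1]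
    by auto
qed

text \<open>The coefficient matrix conjugated by \<open>diag(1, h)\<close> stays positive
  semidefinite, also where \<open>h = 0\<close>, so its trace against a negative semidefinite
  Hessian cannot be positive.\<close>

lemma elliptic_trace_nonpos:
  assumes e: "elliptic lam Lam a b c" and lam: "0 < lam"
    and q: "\<And>\<xi> \<eta>. P * \<xi>\<^sup>2 + 2 * Q * \<xi> * \<eta> + R * \<eta>\<^sup>2 \<le> 0"
  shows "a * P + 2 * b * h * Q + c * h\<^sup>2 * R \<le> (0::real)"
proof -
  have a: "0 < a" using ellipticD(2)[OF e] lam by simp
  \<comment> \<open>Testing with the vector \<open>(- b / a, 1)\<close> produces the Schur
    complement of \<open>a\<close>.\<close>
  have "0 \<le> lam * ((- b / a)\<^sup>2 + 1\<^sup>2)" using lam by simp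
  also have "\<dots> \<le> a * (- b / a)\<^sup>2 + 2 * b * (- b / a) * 1 + c * 1\<^sup>2"
    by (rule ellipticD(1)[OF e])
  also have "\<dots> = c - b\<^sup>2 / a"
    using a by (simp add: power2_eq_square field_simps)
  finally have k: "0 \<le> c - b\<^sup>2 / a" .
  \<comment> \<open>completing the square in the coefficient matrix\<close>
  have "a * P + 2 * b * h * Q + c * h\<^sup>2 * R =
      a * (P * 1\<^sup>2 + 2 * Q * 1 * (b * h / a) + R * (b * h / a)\<^sup>2) + (c - b\<^sup>2 / a) * (h\<^sup>2 * R)"
    using a by (simp add: power2_eq_square field_simps)
  also have "\<dots> \<le> 0 + 0"
  proof (rule add_mono)
    show "a * (P * 1\<^sup>2 + 2 * Q * 1 * (b * h / a) + R * (b * h / a)\<^sup>2) \<le> 0"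
      using mult_nonneg_nonpos[OF less_imp_le[OF a] q[of 1 "b * h / a"]] by simp
    have "R \<le> 0" using q[of 0 1] by simp
    then show "(c - b\<^sup>2 / a) * (h\<^sup>2 * R) \<le> 0"
      using k by (simp add: mult_nonneg_nonpos)
  qed
  finally show ?thesis by simp
qed

definition quad2 :: "real \<Rightarrow> real \<Rightarrow> real \<Rightarrow> real \<times> real \<Rightarrow> real" where
  "quad2 P Q R \<xi> = P * (fst \<xi>)\<^sup>2 + 2 * Q * fst \<xi> * snd \<xi> + R * (snd \<xi>)\<^sup>2"

text \<open>The coefficients are chosen anew at each point, so one predicate covers all operators
  with the given ellipticity constants; \<open>P\<close>, \<open>Q\<close>, \<open>R\<close> are the
  Hessian entries.\<close>

definition strict_subsol ::
  "real \<Rightarrow> real \<Rightarrow> (real \<Rightarrow> real) \<Rightarrow> (real \<times> real \<Rightarrow> real) \<Rightarrow> real \<times> real \<Rightarrow> bool" where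
  "strict_subsol lam Lam h w x \<longleftrightarrow>
     (\<exists>a b c P Q R. elliptic lam Lam a b c \<and>
        0 < a * P + 2 * b * h (fst x) * Q + c * (h (fst x))\<^sup>2 * R \<and>
        (\<forall>\<xi>. second_along w x \<xi> (quad2 P Q R \<xi>)))"

lemma strict_subsol_no_local_max:
  assumes "strict_subsol lam Lam h w x" "0 < lam"
  shows "\<not> (\<forall>\<^sub>F z in nhds x. w z \<le> w x)"
proof
  assume max: "\<forall>\<^sub>F z in nhds x. w z \<le> w x"
  obtain a b c P Q R where e: "elliptic lam Lam a b c"
    and pos: "0 < a * P + 2 * b * h (fst x) * Q + c * (h (fst x))\<^sup>2 * R"
    and s: "\<And>\<xi>. second_along w x \<xi> (quad2 P Q R \<xi>)"
    using assms(1) unfolding strict_subsol_def by blast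
  have "P * \<xi>\<^sup>2 + 2 * Q * \<xi> * \<eta> + R * \<eta>\<^sup>2 \<le> 0" for \<xi> \<eta>
    using second_along_local_max[OF s[of "(\<xi>, \<eta>)"] max] by (simp add: quad2_def)
  from elliptic_trace_nonpos[OF e assms(2) this] pos show False by (meson not_le)
qed

text \<open>If the component of \<open>{w > 0}\<close> containing \<open>z\<close> stayed in
  \<open>Q\<close>, then \<open>w\<close> would attain a positive maximum over its closure, at a
  point of the open component itself, against the maximum principle. So a path in the component
  leaves \<open>Q\<close>, and it is cut where it first does so.\<close>

lemma escape_path:
  fixes w :: "real \<times> real \<Rightarrow> real"
  assumes lam: "0 < lam" and op: "open \<Omega>" and cont: "continuous_on \<Omega> w"
    and Q: "compact Q" "Q \<subseteq> \<Omega>" and z: "z \<in> Q" "0 < w z"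
    and sub: "\<And>x. x \<in> Q \<Longrightarrow> 0 < w x \<Longrightarrow> strict_subsol lam Lam h w x"
  obtains g where "path g" "pathstart g = z" "path_image g \<subseteq> Q \<inter> {x. 0 < w x}"
    "pathfinish g \<in> frontier Q"
proof -
  define S where "S = {x\<in>\<Omega>. 0 < w x}"
  define K where "K = connected_component_set S z"
  have "open (\<Omega> \<inter> w -` {0<..})"
    by (rule continuous_open_preimage[OF cont op]) simp
  then have oS: "open S" by (simp add: S_def Int_def vimage_def)
  then have oK: "open K" unfolding K_def by (rule open_connected_component)
  have KS: "K \<subseteq> S" unfolding K_def by (rule connected_component_subset)
  have zS: "z \<in> S" using z Q by (auto simp: S_def)
  then have zK: "z \<in> K" by (simp add: K_def)
  have "\<not> K \<subseteq> Q"
  proof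
    assume KQ: "K \<subseteq> Q"
    then have clQ: "closure K \<subseteq> Q"
      using Q by (simp add: closure_minimal compact_imp_closed)
    have "bounded K" using KQ Q bounded_subset compact_imp_bounded by blast
    then have "compact (closure K)" by simp
    moreover have "closure K \<noteq> {}" using zK by auto
    moreover have "continuous_on (closure K) w"
      using cont clQ Q continuous_on_subset by blast
    ultimately obtain x where x: "x \<in> closure K" "\<And>y. y \<in> closure K \<Longrightarrow> w y \<le> w x"
      using continuous_attains_sup[of "closure K" w] by blast
    have wx: "0 < w x" using x(2)[of z] zK z closure_subset[of K] by force
    have xQ: "x \<in> Q" using x clQ by auto
    then have xS: "x \<in> S" using wx Q by (auto simp: S_def)
    \<comment> \<open>Components are relatively closed, so a limit point of \<open>K\<close> where
      \<open>w\<close> is still positive belongs to \<open>K\<close>.\<close>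
    have "closedin (top_of_set S) K" unfolding K_def by (rule closedin_connected_component)
    then obtain T where "closed T" "K = S \<inter> T" by (auto simp: closedin_closed)
    then have "closure K \<subseteq> T" by (simp add: closure_minimal)
    with \<open>K = S \<inter> T\<close> x xS have "x \<in> K" by auto
    then have "\<forall>\<^sub>F y in nhds x. w y \<le> w x"
      unfolding eventually_nhds using x(2) closure_subset[of K] oK by blast
    then show False
      using strict_subsol_no_local_max[OF sub[OF xQ wx] lam] by simp
  qed
  then obtain y where y: "y \<in> K" "y \<notin> Q" by auto
  have "path_connected K"
    using oK unfolding K_def by (simp add: connected_open_path_connected)
  then obtain g where g: "path g" "path_image g \<subseteq> K" "pathstart g = z" "pathfinish g = y"
    using zK y unfolding path_connected_def by blast
  obtain g' where "path g'" "pathstart g' = pathstart g" "path_image g' \<subseteq> path_image g \<inter> Q"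
    "pathfinish g' \<in> frontier Q"
    using exists_path_subpath_to_frontier_closed[of Q g] g z y Q compact_imp_closed by metis
  moreover have "path_image g \<subseteq> {x. 0 < w x}" using g KS by (auto simp: S_def)
  ultimately show ?thesis using g that[of g'] by blast
qed

subsection \<open>Barriers and crossing paths\<close>

text \<open>Clamping both paths to the rectangle creates no new intersections, because the first path
  stays strictly inside the horizontal strip and the second one strictly inside the vertical strip.\<close>

lemma paths_cross:
  fixes f g :: "real \<Rightarrow> real \<times> real"
  assumes f: "path f" "fst (pathstart f) \<le> a" "b \<le> fst (pathfinish f)"
    "\<And>x. x \<in> path_image f \<Longrightarrow> c < snd x \<and> snd x < d"
    and g: "path g" "snd (pathstart g) \<le> c" "d \<le> snd (pathfinish g)"
    "\<And>x. x \<in> path_image g \<Longrightarrow> a < fst x \<and> fst x < b"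
  shows "path_image f \<inter> path_image g \<noteq> {}"
proof -
  have ab: "a < b" "c < d" using f(4)[of "pathstart f"] g(4)[of "pathstart g"] by force+
  define A B :: "real^2" where "A = vector [a, c]" and "B = vector [b, d]"
  define J :: "real \<times> real \<Rightarrow> real^2"
    where "J p = (\<chi> i. if i = 1 then max a (min b (fst p)) else max c (min d (snd p)))" for p
  have J: "J p $ 1 = max a (min b (fst p))" "J p $ 2 = max c (min d (snd p))" for p
    by (simp_all add: J_def)
  have J_cont: "continuous_on UNIV J"
  proof -
    have "continuous_on UNIV (\<lambda>p::real \<times> real. if i = (1::2) then max a (min b (fst p)) else max c (min d (snd p)))"
      for i by (cases "i = 1") (auto intro!: continuous_intros)
    then show ?thesis unfolding J_def by (rule continuous_on_vec_lambda)
  qed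
  have box: "path_image (J \<circ> p) \<subseteq> cbox A B" for p
    using ab by (auto simp: path_image_def mem_box_cart forall_2 J A_def B_def)
  obtain z where "z \<in> path_image (J \<circ> f)" "z \<in> path_image (J \<circ> g)"
  proof (rule fashoda[of "J \<circ> f" "J \<circ> g" A B])
    show "path (J \<circ> f)" "path (J \<circ> g)"
      using f g J_cont by (auto intro!: path_continuous_image continuous_on_subset[OF J_cont])
    show "pathstart (J \<circ> f) $ 1 = A $ 1" "pathfinish (J \<circ> f) $ 1 = B $ 1"
      using f ab by (auto simp: pathstart_compose pathfinish_compose J A_def B_def)
    show "pathstart (J \<circ> g) $ 2 = A $ 2" "pathfinish (J \<circ> g) $ 2 = B $ 2"
      using g ab by (auto simp: pathstart_compose pathfinish_compose J A_def B_def)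
  qed (use box in auto)
  then obtain p q where pq: "p \<in> path_image f" "q \<in> path_image g" "J p = J q"
    by (auto simp: path_image_compose)
  have "max a (min b (fst p)) = max a (min b (fst q))" "max c (min d (snd p)) = max c (min d (snd q))"
    using pq(3) J by metis+
  then have "p = q"
    using f(4)[OF pq(1)] g(4)[OF pq(2)] by (auto simp: prod_eq_iff max_def min_def split: if_splits)
  with pq show ?thesis by auto
qed

section \<open>Exponential barriers\<close>

definition weighted_sq :: "real \<Rightarrow> real \<Rightarrow> real \<times> real \<Rightarrow> real \<times> real \<Rightarrow> real" where
  "weighted_sq A B p x = A * (fst x - fst p)\<^sup>2 + B * (snd x - snd p)\<^sup>2"

text \<open>For positive \<open>k\<close> and \<open>\<alpha>\<close> it is positive exactly on the
  open ellipse \<open>weighted_sq A B p x < c\<close>.\<close>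

definition barrier :: "real \<Rightarrow> real \<Rightarrow> real \<Rightarrow> real \<Rightarrow> real \<Rightarrow> real \<times> real \<Rightarrow> real \<times> real \<Rightarrow> real" where
  "barrier k \<alpha> c A B p x = k * (exp (- \<alpha> * weighted_sq A B p x) - exp (- \<alpha> * c))"

lemma continuous_on_weighted_sq [continuous_intros]: "continuous_on S (weighted_sq A B p)"
  unfolding weighted_sq_def[abs_def] by (intro continuous_intros)

lemma weighted_sq_ge:
  assumes "0 \<le> A" "0 \<le> B"
  shows "A * (fst x - fst p)\<^sup>2 \<le> weighted_sq A B p x" "B * (snd x - snd p)\<^sup>2 \<le> weighted_sq A B p x"
  using assms by (simp_all add: weighted_sq_def)

lemma continuous_on_barrier [continuous_intros]: "continuous_on S (barrier k \<alpha> c A B p)"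
  unfolding barrier_def[abs_def] by (intro continuous_intros)

text \<open>With \<open>\<rho>\<close> the weighted square, the Hessian of
  \<open>k * exp (- \<alpha> * \<rho>)\<close> is \<open>E\<close> times (\<open>\<alpha>\<close>
  times the square of the gradient of \<open>\<rho>\<close>, minus the Hessian of
  \<open>\<rho>\<close>).\<close>

lemma barrier_second_along:
  fixes k \<alpha> A B :: real and p :: "real \<times> real"
  defines "E \<equiv> \<lambda>x. k * \<alpha> * exp (- \<alpha> * weighted_sq A B p x)"
  shows "second_along (barrier k \<alpha> c A B p) x \<xi>
    (quad2 (E x * (\<alpha> * (2 * A * (fst x - fst p))\<^sup>2 - 2 * A))
           (E x * (\<alpha> * (2 * A * (fst x - fst p)) * (2 * B * (snd x - snd p))))
           (E x * (\<alpha> * (2 * B * (snd x - snd p))\<^sup>2 - 2 * B)) \<xi>)"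
proof -
  obtain s t m n e f where [simp]: "x = (s, t)" "p = (m, n)" "\<xi> = (e, f)"
    by (metis surj_pair)
  define w' where "w' \<tau> = - (k * \<alpha> * exp (- \<alpha> * (A * (s + \<tau> * e - m)\<^sup>2 + B * (t + \<tau> * f - n)\<^sup>2))) *
    (2 * A * (s + \<tau> * e - m) * e + 2 * B * (t + \<tau> * f - n) * f)" for \<tau>
  have "((\<lambda>\<tau>. barrier k \<alpha> c A B p (x + \<tau> *\<^sub>R \<xi>)) has_real_derivative w' \<tau>) (at \<tau>)" for \<tau>
    unfolding barrier_def weighted_sq_def w'_def
    by (auto intro!: derivative_eq_intros simp: algebra_simps)
  moreover have "(w' has_real_derivative
      quad2 (E x * (\<alpha> * (2 * A * (fst x - fst p))\<^sup>2 - 2 * A))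
           (E x * (\<alpha> * (2 * A * (fst x - fst p)) * (2 * B * (snd x - snd p))))
           (E x * (\<alpha> * (2 * B * (snd x - snd p))\<^sup>2 - 2 * B)) \<xi>) (at 0)"
    unfolding w'_def E_def quad2_def weighted_sq_def
    by (auto intro!: derivative_eq_intros simp: power2_eq_square algebra_simps)
  ultimately show ?thesis
    unfolding second_along_def by (intro exI[of _ w']) simp
qed

text \<open>Ellipticity bounds the gradient term below by \<open>lam\<close> and the trace term
  above by \<open>Lam\<close>; \<open>G\<close> says that the former wins.\<close>

lemma barrier_pos:
  assumes e: "elliptic lam Lam a b c'" and k: "0 < k" and al: "0 < \<alpha>" and A: "0 \<le> A" and B: "0 \<le> B"
    and G: "Lam * (A + B * h\<^sup>2) < 2 * \<alpha> * lam * ((A * (fst x - fst p))\<^sup>2 + (h * B * (snd x - snd p))\<^sup>2)"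
  defines "E \<equiv> k * \<alpha> * exp (- \<alpha> * weighted_sq A B p x)"
  shows "0 < a * (E * (\<alpha> * (2 * A * (fst x - fst p))\<^sup>2 - 2 * A))
    + 2 * b * h * (E * (\<alpha> * (2 * A * (fst x - fst p)) * (2 * B * (snd x - snd p))))
    + c' * h\<^sup>2 * (E * (\<alpha> * (2 * B * (snd x - snd p))\<^sup>2 - 2 * B))"
proof -
  define X Y where "X = A * (fst x - fst p)" and "Y = h * B * (snd x - snd p)"
  have E: "0 < E" using k al by (simp add: E_def)
  have "a * A + c' * (B * h\<^sup>2) \<le> Lam * A + Lam * (B * h\<^sup>2)"
    using ellipticD[OF e] A B by (intro add_mono mult_right_mono) auto
  then have 1: "a * A + c' * (B * h\<^sup>2) \<le> Lam * (A + B * h\<^sup>2)" by (simp add: algebra_simps)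
  have "2 * \<alpha> * (lam * (X\<^sup>2 + Y\<^sup>2)) \<le> 2 * \<alpha> * (a * X\<^sup>2 + 2 * b * X * Y + c' * Y\<^sup>2)"
    by (intro mult_left_mono ellipticD(1)[OF e]) (use al in auto)
  with 1 G have "0 < 2 * \<alpha> * (a * X\<^sup>2 + 2 * b * X * Y + c' * Y\<^sup>2) - (a * A + c' * (B * h\<^sup>2))"
    by (simp add: X_def Y_def algebra_simps)
  then have "0 < (2 * E) * (2 * \<alpha> * (a * X\<^sup>2 + 2 * b * X * Y + c' * Y\<^sup>2) - (a * A + c' * (B * h\<^sup>2)))"
    using E by simp
  also have "\<dots> = a * (E * (\<alpha> * (2 * A * (fst x - fst p))\<^sup>2 - 2 * A))
    + 2 * b * h * (E * (\<alpha> * (2 * A * (fst x - fst p)) * (2 * B * (snd x - snd p))))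
    + c' * h\<^sup>2 * (E * (\<alpha> * (2 * B * (snd x - snd p))\<^sup>2 - 2 * B))"
    by (simp add: X_def Y_def power2_eq_square algebra_simps)
  finally show ?thesis .
qed

text \<open>Only pointwise data enter: some admissible matrix and some Hessian entries at each
  point. This makes the notion stable under the affine rescaling.\<close>

definition grushin_sol ::
  "real \<Rightarrow> real \<Rightarrow> (real \<Rightarrow> real) \<Rightarrow> (real \<times> real) set \<Rightarrow> (real \<times> real \<Rightarrow> real) \<Rightarrow> bool" where
  "grushin_sol lam Lam h \<Omega> u \<longleftrightarrow> continuous_on \<Omega> u \<and>
     (\<forall>x\<in>\<Omega>. 0 \<le> u x \<and> (\<exists>a b c P Q R. elliptic lam Lam a b c \<and>
        a * P + 2 * b * h (fst x) * Q + c * (h (fst x))\<^sup>2 * R = 0 \<and>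
        (\<forall>\<xi>. second_along u x \<xi> (quad2 P Q R \<xi>))))"

text \<open>The difference \<open>v - u\<close> is a strict subsolution on the truncated ellipse, so
  its positivity set reaches the frontier. On the part \<open>weighted_sq = c\<close> the barrier
  vanishes while \<open>u\<close> is nonnegative, which leaves only the cut
  \<open>\<kappa> = 0\<close>.\<close>

lemma barrier_path:
  fixes k \<alpha> c A B :: real and p :: "real \<times> real" and \<kappa> :: "real \<times> real \<Rightarrow> real"
  defines "v \<equiv> barrier k \<alpha> c A B p"
  assumes lam: "0 < lam" and op: "open \<Omega>" and u: "grushin_sol lam Lam h \<Omega> u"
    and pos: "0 < k" "0 < \<alpha>" "0 \<le> A" "0 \<le> B"
    and \<kappa>: "continuous_on UNIV \<kappa>"
    and Q: "compact {x. weighted_sq A B p x \<le> c \<and> 0 \<le> \<kappa> x}" "{x. weighted_sq A B p x \<le> c \<and> 0 \<le> \<kappa> x} \<subseteq> \<Omega>"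
    and G: "\<And>x. weighted_sq A B p x \<le> c \<Longrightarrow> 0 \<le> \<kappa> x \<Longrightarrow> Lam * (A + B * (h (fst x))\<^sup>2) <
        2 * \<alpha> * lam * ((A * (fst x - fst p))\<^sup>2 + (h (fst x) * B * (snd x - snd p))\<^sup>2)"
    and z: "0 \<le> \<kappa> z" "u z < v z" "0 \<le> u z"
  obtains g where "path g" "pathstart g = z"
    "\<And>x. x \<in> path_image g \<Longrightarrow> weighted_sq A B p x < c \<and> 0 \<le> \<kappa> x \<and> u x < v x"
    "\<kappa> (pathfinish g) = 0"
proof -
  let ?Q = "{x. weighted_sq A B p x \<le> c \<and> 0 \<le> \<kappa> x}"
  have v_pos: "weighted_sq A B p x < c" if "0 < v x" for x
    using that pos by (simp add: v_def barrier_def zero_less_mult_iff)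
  have sub: "strict_subsol lam Lam h (\<lambda>x. v x + - u x) x" if "x \<in> ?Q" for x
  proof -
    have "x \<in> \<Omega>" using that Q by auto
    then obtain a b c' P S R where e: "elliptic lam Lam a b c'"
      and eq: "a * P + 2 * b * h (fst x) * S + c' * (h (fst x))\<^sup>2 * R = 0"
      and s: "\<And>\<xi>. second_along u x \<xi> (quad2 P S R \<xi>)"
      using u unfolding grushin_sol_def by blast
    define E where "E = k * \<alpha> * exp (- \<alpha> * weighted_sq A B p x)"
    define P' where "P' = E * (\<alpha> * (2 * A * (fst x - fst p))\<^sup>2 - 2 * A)"
    define S' where "S' = E * (\<alpha> * (2 * A * (fst x - fst p)) * (2 * B * (snd x - snd p)))"
    define R' where "R' = E * (\<alpha> * (2 * B * (snd x - snd p))\<^sup>2 - 2 * B)"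
    have "0 < a * P' + 2 * b * h (fst x) * S' + c' * (h (fst x))\<^sup>2 * R'"
      unfolding P'_def S'_def R'_def E_def
      by (rule barrier_pos[OF e]) (use pos G that in auto)
    with eq have *: "0 < a * (P' - P) + 2 * b * h (fst x) * (S' - S) + c' * (h (fst x))\<^sup>2 * (R' - R)"
      by (simp add: algebra_simps)
    have "second_along (\<lambda>x. v x + - u x) x \<xi> (quad2 P' S' R' \<xi> + - quad2 P S R \<xi>)" for \<xi>
      unfolding v_def P'_def S'_def R'_def E_def
      by (intro second_along_add second_along_minus s barrier_second_along)
    moreover have "quad2 P' S' R' \<xi> + - quad2 P S R \<xi> = quad2 (P' - P) (S' - S) (R' - R) \<xi>" for \<xi>
      by (simp add: quad2_def algebra_simps)
    ultimately show ?thesis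
      unfolding strict_subsol_def using e * by (metis (no_types, lifting))
  qed
  have cont: "continuous_on \<Omega> (\<lambda>x. v x + - u x)"
    using u unfolding grushin_sol_def v_def by (intro continuous_intros) auto
  have zQ: "z \<in> ?Q" using z v_pos[of z] by auto
  obtain g where g: "path g" "pathstart g = z" "path_image g \<subseteq> ?Q \<inter> {x. 0 < v x + - u x}"
    "pathfinish g \<in> frontier ?Q"
    by (rule escape_path[OF lam op cont Q zQ, where h = h and Lam = Lam]) (use sub z in auto)
  have im: "weighted_sq A B p x < c \<and> 0 \<le> \<kappa> x \<and> u x < v x" if "x \<in> path_image g" for x
  proof -
    have "x \<in> ?Q" "u x < v x" using g that by auto
    moreover have "0 \<le> u x" using \<open>x \<in> ?Q\<close> Q u by (auto simp: grushin_sol_def)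
    ultimately show ?thesis using v_pos[of x] by auto
  qed
  let ?f = "pathfinish g"
  have f: "weighted_sq A B p ?f < c" "0 \<le> \<kappa> ?f" using im[of ?f] by auto
  have "\<kappa> ?f = 0"
  proof (rule ccontr)
    assume "\<kappa> ?f \<noteq> 0"
    let ?U = "{x. weighted_sq A B p x < c} \<inter> {x. 0 < \<kappa> x}"
    have "open ?U"
      by (intro open_Int open_Collect_less[OF continuous_on_const[of UNIV 0] \<kappa>] open_Collect_less continuous_intros)
    moreover have "?U \<subseteq> ?Q" by auto
    moreover have "?f \<in> ?U" using f \<open>\<kappa> ?f \<noteq> 0\<close> by auto
    ultimately have "?f \<in> interior ?Q" by (meson interiorI)
    with g show False by (simp add: frontier_def)
  qed
  then show ?thesis using that g im by blast
qed

subsection \<open>The rescaled Harnack inequality\<close>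

lemma second_along_fst_square:
  "second_along (\<lambda>x. e * (fst x)\<^sup>2 - d) (x :: real \<times> real) \<xi> (quad2 (2 * e) 0 0 \<xi>)"
proof -
  let ?w' = "\<lambda>\<tau>. 2 * e * (fst x + \<tau> * fst \<xi>) * fst \<xi>"
  have "((\<lambda>\<tau>. e * (fst (x + \<tau> *\<^sub>R \<xi>))\<^sup>2 - d) has_real_derivative ?w' \<tau>) (at \<tau>)" for \<tau>
    by (auto intro!: derivative_eq_intros)
  moreover have "(?w' has_real_derivative quad2 (2 * e) 0 0 \<xi>) (at 0)"
    by (auto intro!: derivative_eq_intros simp: quad2_def power2_eq_square)
  ultimately show ?thesis unfolding second_along_def by (intro exI[of _ ?w']) simp
qed

text \<open>
  The factor \<open>10 ^ 12\<close> is generous: the proofs below need \<open>2 \<alpha> \<lambda> g > 901 \<Lambda>\<close>, where \<open>g = 10 ^ -8\<close> bounds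
  the squared horizontal gradients from below (see \<open>box_barrier_path\<close>).
\<close>

locale grushin_box =
  fixes lam Lam \<beta> \<gamma> :: real and u :: "real \<times> real \<Rightarrow> real" and h :: "real \<Rightarrow> real" and \<alpha> :: real
    and \<Omega> :: "(real \<times> real) set"
  defines "h \<equiv> \<lambda>t. \<beta> + \<gamma> * t" and "\<alpha> \<equiv> 10 ^ 12 * Lam / lam"
    and "\<Omega> \<equiv> {-30<..<30} \<times> {-30<..<30}"
  assumes lam: "0 < lam" "lam \<le> Lam"
    and norm: "0 \<le> \<gamma>" "\<bar>\<beta>\<bar> + \<gamma> = 1"
    and sol: "grushin_sol lam Lam h \<Omega> u"
begin

section \<open>Bounds for \<open>h\<close> and for barriers on the box\<close>

lemma alpha_pos: "0 < \<alpha>"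
  using lam by (simp add: \<alpha>_def)

lemma nonneg: "x \<in> \<Omega> \<Longrightarrow> 0 \<le> u x"
  using sol by (auto simp: grushin_sol_def)

lemma abs_h_le:
  assumes "\<bar>t\<bar> \<le> 30"
  shows "\<bar>h t\<bar> \<le> 30"
proof -
  have "\<bar>\<gamma> * t\<bar> \<le> \<gamma> * 30"
    using norm assms by (simp add: abs_mult mult_left_mono)
  then show ?thesis using norm by (simp add: h_def)
qed

lemma abs_h_diff:
  "\<bar>h t - h m\<bar> = \<gamma> * \<bar>t - m\<bar>"
proof -
  have "h t - h m = \<gamma> * (t - m)" by (simp add: h_def algebra_simps)
  then show ?thesis using norm by (simp add: abs_mult)
qed

text \<open>Either the slope \<open>\<gamma>\<close> is at least 1/16 and the two values differ by
  at least 1/8, or \<open>\<bar>\<beta>\<bar> > 15/16\<close> dominates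
  \<open>\<gamma> * m\<close>.\<close>

lemma h_nondegenerate:
  assumes "\<bar>m\<bar> \<le> 7" "\<bar>m' - m\<bar> = 2"
  shows "1/16 \<le> \<bar>h m\<bar> \<or> 1/16 \<le> \<bar>h m'\<bar>"
proof (cases "1/16 \<le> \<gamma>")
  case True
  then show ?thesis using abs_h_diff[of m' m] assms by auto
next
  case False
  have "\<bar>\<gamma> * m\<bar> \<le> (1/16) * 7"
    unfolding abs_mult using norm assms False by (intro mult_mono) auto
  then show ?thesis using norm False unfolding h_def by argo
qed

lemma h_near:
  assumes "1/16 \<le> \<bar>h m\<bar>" "\<bar>t - m\<bar> \<le> 1/32"
  shows "(1/32)\<^sup>2 \<le> (h t)\<^sup>2"
proof -
  have "\<gamma> * \<bar>t - m\<bar> \<le> 1 * (1/32)"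
    using norm assms by (intro mult_mono) auto
  then have "1/32 \<le> \<bar>h t\<bar>" using abs_h_diff[of t m] assms by argo
  then have "(1/32)\<^sup>2 \<le> \<bar>h t\<bar>\<^sup>2" by (intro power_mono) auto
  then show ?thesis by simp
qed

lemma box_barrier_path:
  fixes \<kappa> :: "real \<times> real \<Rightarrow> real"
  assumes k: "0 < k" and AB: "0 \<le> A" "A \<le> 1" "0 \<le> B" "B \<le> 1"
    and \<kappa>: "continuous_on UNIV \<kappa>"
    and sub: "\<And>x. weighted_sq A B p x \<le> c \<Longrightarrow> 0 \<le> \<kappa> x \<Longrightarrow> x \<in> \<Omega>"
    and G: "\<And>x. weighted_sq A B p x \<le> c \<Longrightarrow> 0 \<le> \<kappa> x \<Longrightarrow>
        1 / 10 ^ 8 \<le> (A * (fst x - fst p))\<^sup>2 + (h (fst x) * B * (snd x - snd p))\<^sup>2"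
    and z: "0 \<le> \<kappa> z" "u z < barrier k \<alpha> c A B p z" "0 \<le> u z"
  obtains g where "path g" "pathstart g = z"
    "\<And>x. x \<in> path_image g \<Longrightarrow> weighted_sq A B p x < c \<and> 0 \<le> \<kappa> x \<and> u x < barrier k \<alpha> c A B p x"
    "\<kappa> (pathfinish g) = 0"
proof (rule barrier_path[OF lam(1) _ sol k alpha_pos AB(1,3) \<kappa> _ _ _ z])
  show "open \<Omega>" by (simp add: \<Omega>_def open_Times)
  show Q: "{x. weighted_sq A B p x \<le> c \<and> 0 \<le> \<kappa> x} \<subseteq> \<Omega>" using sub by auto
  have "bounded \<Omega>" by (simp add: \<Omega>_def bounded_Times)
  then have "bounded {x. weighted_sq A B p x \<le> c \<and> 0 \<le> \<kappa> x}" using Q bounded_subset by blast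
  moreover have "closed {x. weighted_sq A B p x \<le> c \<and> 0 \<le> \<kappa> x}"
    by (intro closed_Collect_conj closed_Collect_le[OF continuous_on_const[of UNIV 0] \<kappa>] closed_Collect_le continuous_intros)
  ultimately show "compact {x. weighted_sq A B p x \<le> c \<and> 0 \<le> \<kappa> x}" by (simp add: compact_eq_bounded_closed)
next
  fix x assume x: "weighted_sq A B p x \<le> c" "0 \<le> \<kappa> x"
  have "\<bar>h (fst x)\<bar>\<^sup>2 \<le> 30\<^sup>2"
    using sub[OF x] by (intro power_mono abs_h_le) (auto simp: \<Omega>_def)
  then have "B * (h (fst x))\<^sup>2 \<le> 1 * 900" using AB by (intro mult_mono) auto
  then have "Lam * (A + B * (h (fst x))\<^sup>2) \<le> Lam * 901"
    using AB lam by (intro mult_left_mono) auto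
  also have "\<dots> < 2 * \<alpha> * lam * (1 / 10 ^ 8)"
    using lam by (simp add: \<alpha>_def)
  also have "\<dots> \<le> 2 * \<alpha> * lam * ((A * (fst x - fst p))\<^sup>2 + (h (fst x) * B * (snd x - snd p))\<^sup>2)"
    using alpha_pos lam G[OF x] by (intro mult_left_mono) auto
  finally show "Lam * (A + B * (h (fst x))\<^sup>2) <
      2 * \<alpha> * lam * ((A * (fst x - fst p))\<^sup>2 + (h (fst x) * B * (snd x - snd p))\<^sup>2)" .
qed (use that in blast)

text \<open>The upper bound keeps \<open>{u < v}\<close> away from \<open>{k < u}\<close>; the lower
  one is what a crossing passes on to the target square.\<close>

lemma barrier_unit_bounds:
  assumes "0 < k" "0 \<le> A" "0 \<le> B"
  shows "barrier k \<alpha> 1 A B p x < k"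
    "weighted_sq A B p x \<le> 3/4 \<Longrightarrow> k * (exp (- \<alpha> * (3/4)) - exp (- \<alpha>)) \<le> barrier k \<alpha> 1 A B p x"
proof -
  have "0 \<le> weighted_sq A B p x" using assms by (simp add: weighted_sq_def)
  then have "exp (- \<alpha> * weighted_sq A B p x) \<le> 1" using alpha_pos by simp
  then have "exp (- \<alpha> * weighted_sq A B p x) - exp (- \<alpha> * 1) < 1"
    using exp_gt_zero[of "- \<alpha> * 1"] by linarith
  then show "barrier k \<alpha> 1 A B p x < k"
    using assms(1) by (simp add: barrier_def)
  assume "weighted_sq A B p x \<le> 3/4"
  then show "k * (exp (- \<alpha> * (3/4)) - exp (- \<alpha>)) \<le> barrier k \<alpha> 1 A B p x"
    using assms(1) alpha_pos by (simp add: barrier_def)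
qed

section \<open>Lower bounds from crossing paths\<close>

text \<open>
  The pole \<open>(m, -5)\<close> and the target square around \<open>(m, 5)\<close> lie on opposite sides of any path that crosses
  the strip \<open>\<bar>t - m\<bar> \<le> 1\<close> at heights between \<open>-3\<close> and \<open>3\<close>; \<open>h m\<close> must not vanish since the barrier is
  critical in \<open>t\<close> on the axis of the strip.
\<close>

lemma horizontal_crossing:
  assumes f: "path f" "fst (pathstart f) \<le> m - 1" "m + 1 \<le> fst (pathfinish f)"
    and im: "\<And>x. x \<in> path_image f \<Longrightarrow> \<bar>snd x\<bar> \<le> 3 \<and> k < u x" and k: "0 < k"
    and m: "\<bar>m\<bar> \<le> 4" "1/16 \<le> \<bar>h m\<bar>"
    and x: "\<bar>fst x - m\<bar> \<le> 1/4" "\<bar>snd x - 5\<bar> \<le> 1/4"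
  shows "k * (exp (- \<alpha> * (3/4)) - exp (- \<alpha>)) \<le> u x"
proof (rule ccontr)
  assume not: "\<not> ?thesis"
  \<comment> \<open>The ellipse has half-width 1 and vertical reach below 15. At the target the
    weighted square is at most \<open>1/16 + (41/4)^2/200 < 3/4\<close>.\<close>
  let ?v = "barrier k \<alpha> 1 1 (1/200) (m, -5)"
  have narrow: "\<bar>fst y - m\<bar> \<le> 1" "\<bar>snd y + 5\<bar> \<le> 15" if "weighted_sq 1 (1/200) (m, -5) y \<le> 1" for y
  proof -
    have "(fst y - m)\<^sup>2 \<le> 1\<^sup>2" "(snd y + 5)\<^sup>2 \<le> 15\<^sup>2"
      using that weighted_sq_ge[of 1 "1/200" y "(m, -5)"] by auto
    then show "\<bar>fst y - m\<bar> \<le> 1" "\<bar>snd y + 5\<bar> \<le> 15"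
      using abs_le_square_iff[of "fst y - m" 1] abs_le_square_iff[of "snd y + 5" 15] by auto
  qed
  have xb: "m - 1/4 \<le> fst x" "fst x \<le> m + 1/4" "5 - 1/4 \<le> snd x" "snd x \<le> 5 + 1/4"
    using x unfolding abs_le_iff by linarith+
  have "(fst x - m)\<^sup>2 \<le> (1/4)\<^sup>2" "(snd x + 5)\<^sup>2 \<le> (41/4)\<^sup>2"
    using x xb abs_le_square_iff[of "fst x - m" "1/4"] by (auto intro!: power_mono)
  then have "weighted_sq 1 (1/200) (m, -5) x \<le> 3/4" by (simp add: weighted_sq_def power_divide)
  then have "k * (exp (- \<alpha> * (3/4)) - exp (- \<alpha>)) \<le> ?v x"
    using k by (intro barrier_unit_bounds(2)) (auto simp: power2_eq_square)
  with not have uv: "u x < ?v x" by linarith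
  have x0: "0 \<le> u x" using xb m by (intro nonneg) (auto simp: \<Omega>_def mem_Times_iff abs_le_iff)
  \<comment> \<open>The cut at height -4 lies below \<open>f\<close> and keeps the region at
    distance 1 from the pole; \<open>g\<close> runs down to it from above height 4.\<close>
  obtain g where g: "path g" "pathstart g = x"
    "\<And>y. y \<in> path_image g \<Longrightarrow> weighted_sq 1 (1/200) (m, -5) y < 1 \<and> 0 \<le> snd y + 4 \<and> u y < ?v y"
    "snd (pathfinish g) + 4 = 0"
  proof (rule box_barrier_path[where A = 1 and B = "1/200" and k = k and c = 1 and p = "(m, -5)"
        and \<kappa> = "\<lambda>x. snd x + 4" and z = x])
    fix y assume y: "weighted_sq 1 (1/200) (m, -5) y \<le> 1" "0 \<le> snd y + 4"
    show "y \<in> \<Omega>" using narrow[OF y(1)] m by (auto simp: \<Omega>_def mem_Times_iff abs_le_iff)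
    show "1 / 10 ^ 8 \<le> (1 * (fst y - fst (m, -5)))\<^sup>2 + (h (fst y) * (1/200) * (snd y - snd (m, -5 :: real)))\<^sup>2"
    \<comment> \<open>Near the axis the \<open>t\<close>-derivative may vanish, but
      \<open>\<bar>h\<bar> \<ge> 1/32\<close> and the vertical distance to the pole is at least 1.
      This gives \<open>1/(32 * 200)^2\<close>, the source of the threshold
      \<open>1 / 10 ^ 8\<close>.\<close>
    proof (cases "\<bar>fst y - m\<bar> \<le> 1/32")
      case True
      have "1\<^sup>2 \<le> (snd y + 5)\<^sup>2" using y(2) by (intro power_mono) auto
      then have "(1/32)\<^sup>2 * (1/200)\<^sup>2 * 1\<^sup>2 \<le> (h (fst y))\<^sup>2 * (1/200)\<^sup>2 * (snd y + 5)\<^sup>2"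
        using h_near[OF m(2) True] by (intro mult_mono) auto
      then show ?thesis
        by (intro add_increasing) (auto simp: power_mult_distrib power_divide)
    next
      case False
      then have "(1/32)\<^sup>2 \<le> \<bar>fst y - m\<bar>\<^sup>2" by (intro power_mono) auto
      then show ?thesis
        by (intro add_increasing2) (auto simp: power_divide)
    qed
  qed (use k uv x0 xb in \<open>auto intro!: continuous_intros simp: abs_le_iff\<close>)
  have "path_image f \<inter> path_image (reversepath g) \<noteq> {}"
  proof (rule paths_cross[where a = "m - 1" and b = "m + 1" and c = "-4" and d = 4])
    show "- 4 < snd y \<and> snd y < 4" if "y \<in> path_image f" for y
      using im[OF that] by auto
    show "m - 1 < fst y \<and> fst y < m + 1" if "y \<in> path_image (reversepath g)" for y
    proof -
      have "(fst y - m)\<^sup>2 < 1\<^sup>2"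
        using g(3)[of y] that weighted_sq_ge(1)[of 1 "1/200" y "(m, -5)"] by auto
      then have "\<bar>fst y - m\<bar> < 1" using abs_square_less_1 by auto
      then show ?thesis by auto
    qed
  qed (use f g xb in \<open>auto simp: abs_le_iff\<close>)
  then obtain y where "y \<in> path_image f" "y \<in> path_image g" by auto
  then have "k < u y" "u y < ?v y" using im g(3) by auto
  moreover have "?v y < k" using k by (intro barrier_unit_bounds(1)) auto
  ultimately show False by simp
qed

text \<open>
  Here the pole \<open>(-7, n)\<close> keeps the \<open>t\<close>-derivative of the barrier away from zero, so that the
  strip may meet the line \<open>h = 0\<close>.
\<close>

lemma vertical_crossing:
  assumes f: "path f" "snd (pathstart f) \<le> n - 1" "n + 1 \<le> snd (pathfinish f)"
    and im: "\<And>x. x \<in> path_image f \<Longrightarrow> \<bar>fst x\<bar> \<le> 5 \<and> k < u x" and k: "0 < k"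
    and mn: "7 \<le> m" "m \<le> 9" "\<bar>n\<bar> \<le> 2"
    and x: "\<bar>fst x - m\<bar> \<le> 1/4" "\<bar>snd x - n\<bar> \<le> 1/4"
  shows "k * (exp (- \<alpha> * (3/4)) - exp (- \<alpha>)) \<le> u x"
proof (rule ccontr)
  assume not: "\<not> ?thesis"
  \<comment> \<open>The ellipse reaches less than 23 horizontally; the target, at most 65/4 from the
    pole, has weighted square at most \<open>(65/4)^2/512 + 1/16 < 3/4\<close>.\<close>
  let ?v = "barrier k \<alpha> 1 (1/512) 1 (-7, n)"
  have narrow: "\<bar>fst y + 7\<bar> \<le> 23" "\<bar>snd y - n\<bar> \<le> 1" if "weighted_sq (1/512) 1 (-7, n) y \<le> 1" for y
  proof -
    have "(fst y + 7)\<^sup>2 \<le> 23\<^sup>2" "(snd y - n)\<^sup>2 \<le> 1\<^sup>2"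
      using that weighted_sq_ge[of "1/512" 1 y "(-7, n)"] by auto
    then show "\<bar>fst y + 7\<bar> \<le> 23" "\<bar>snd y - n\<bar> \<le> 1"
      using abs_le_square_iff[of "fst y + 7" 23] abs_le_square_iff[of "snd y - n" 1] by auto
  qed
  have xb: "m - 1/4 \<le> fst x" "fst x \<le> m + 1/4" "n - 1/4 \<le> snd x" "snd x \<le> n + 1/4"
    using x unfolding abs_le_iff by linarith+
  have "\<bar>fst x + 7\<bar> \<le> 65/4" using xb mn by simp
  then have "weighted_sq (1/512) 1 (-7, n) x \<le> 1/512 * (65/4)\<^sup>2 + 1 * (1/4)\<^sup>2"
    unfolding weighted_sq_def using x by (intro add_mono mult_left_mono abs_le_square_iff[THEN iffD1]) auto
  then have "k * (exp (- \<alpha> * (3/4)) - exp (- \<alpha>)) \<le> ?v x"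
    using k by (intro barrier_unit_bounds(2)) (auto simp: power2_eq_square)
  with not have uv: "u x < ?v x" by linarith
  have x0: "0 \<le> u x" using xb mn by (intro nonneg) (auto simp: \<Omega>_def mem_Times_iff abs_le_iff)
  obtain g where g: "path g" "pathstart g = x"
    "\<And>y. y \<in> path_image g \<Longrightarrow> weighted_sq (1/512) 1 (-7, n) y < 1 \<and> 0 \<le> fst y + 6 \<and> u y < ?v y"
    "fst (pathfinish g) + 6 = 0"
  proof (rule box_barrier_path[where A = "1/512" and B = 1 and k = k and c = 1 and p = "(-7, n)"
        and \<kappa> = "\<lambda>x. fst x + 6" and z = x])
    fix y assume y: "weighted_sq (1/512) 1 (-7, n) y \<le> 1" "0 \<le> fst y + 6"
    show "y \<in> \<Omega>" using narrow[OF y(1)] y(2) mn by (auto simp: \<Omega>_def mem_Times_iff abs_le_iff)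
    have "1\<^sup>2 \<le> (fst y + 7)\<^sup>2" using y(2) by (intro power_mono) auto
    then show "1 / 10 ^ 8 \<le> (1/512 * (fst y - fst (-7, n)))\<^sup>2 + (h (fst y) * 1 * (snd y - snd (-7 :: real, n)))\<^sup>2"
      by (intro add_increasing2) (auto simp: power_mult_distrib power_divide)
  qed (use k uv x0 xb mn in \<open>auto intro!: continuous_intros simp: abs_le_iff\<close>)
  \<comment> \<open>Now the barrier path plays the horizontal role, reversed so as to run from left
    to right.\<close>
  have "path_image (reversepath g) \<inter> path_image f \<noteq> {}"
  proof (rule paths_cross[where a = "-6" and b = 6 and c = "n - 1" and d = "n + 1"])
    show "- 6 < fst y \<and> fst y < 6" if "y \<in> path_image f" for y
      using im[OF that] by auto
    show "n - 1 < snd y \<and> snd y < n + 1" if "y \<in> path_image (reversepath g)" for y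
    proof -
      have "(snd y - n)\<^sup>2 < 1\<^sup>2"
        using g(3)[of y] that weighted_sq_ge(2)[of "1/512" 1 y "(-7, n)"] by auto
      then have "\<bar>snd y - n\<bar> < 1" using abs_square_less_1 by auto
      then show ?thesis by auto
    qed
  qed (use f g xb mn in \<open>auto simp: abs_le_iff\<close>)
  then obtain y where "y \<in> path_image f" "y \<in> path_image g" by auto
  then have "k < u y" "u y < ?v y" using im g(3) by auto
  moreover have "?v y < k" using k by (intro barrier_unit_bounds(1)) auto
  ultimately show False by simp
qed

text \<open>If the barrier centred at \<open>(m, n)\<close> exceeded \<open>u\<close> at
  \<open>x\<close>, a path with \<open>u < v\<close> would lead to the circle of radius 1/4. There
  \<open>u \<ge> k > v\<close>, a contradiction.\<close>

lemma spread:
  assumes mn: "\<bar>m\<bar> \<le> 9" "\<bar>n\<bar> \<le> 5" "1/16 \<le> \<bar>h m\<bar>" and k: "0 < k"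
    and near: "\<And>x. \<bar>fst x - m\<bar> \<le> 1/4 \<Longrightarrow> \<bar>snd x - n\<bar> \<le> 1/4 \<Longrightarrow> k \<le> u x"
    and x: "\<bar>fst x\<bar> \<le> 1" "\<bar>snd x\<bar> \<le> 1"
  shows "k * (exp (- \<alpha> * 200) - exp (- \<alpha> * 400)) \<le> u x"
proof (rule ccontr)
  assume not: "\<not> ?thesis"
  \<comment> \<open>Radius 20 keeps the disc inside the box, and on the unit square the squared
    distance is at most 136, hence below 200.\<close>
  let ?v = "barrier k \<alpha> 400 1 1 (m, n)"
  have close: "k \<le> u y" if "weighted_sq 1 1 (m, n) y \<le> 1/16" for y
  proof (rule near)
    have "(fst y - m)\<^sup>2 \<le> (1/4)\<^sup>2" "(snd y - n)\<^sup>2 \<le> (1/4)\<^sup>2"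
      using that weighted_sq_ge[of 1 1 y "(m, n)"] by (auto simp: power_divide)
    then show "\<bar>fst y - m\<bar> \<le> 1/4" "\<bar>snd y - n\<bar> \<le> 1/4"
      using abs_le_square_iff[of "fst y - m" "1/4"] abs_le_square_iff[of "snd y - n" "1/4"] by auto
  qed
  have v_less: "?v y < k" for y
  proof -
    have "0 \<le> weighted_sq 1 1 (m, n) y" by (simp add: weighted_sq_def)
    then have "exp (- \<alpha> * weighted_sq 1 1 (m, n) y) \<le> 1" using alpha_pos by simp
    then have "exp (- \<alpha> * weighted_sq 1 1 (m, n) y) - exp (- \<alpha> * 400) < 1"
      using exp_gt_zero[of "- \<alpha> * 400"] by linarith
    then show ?thesis using k by (simp add: barrier_def)
  qed
  have "\<bar>fst x - m\<bar> \<le> 10" "\<bar>snd x - n\<bar> \<le> 6" using x mn by auto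
  then have "weighted_sq 1 1 (m, n) x \<le> 1 * 10\<^sup>2 + 1 * 6\<^sup>2"
    unfolding weighted_sq_def by (intro add_mono mult_left_mono abs_le_square_iff[THEN iffD1]) auto
  then have "k * (exp (- \<alpha> * 200) - exp (- \<alpha> * 400)) \<le> ?v x"
    using k alpha_pos by (auto simp: barrier_def)
  with not have uv: "u x < ?v x" by linarith
  have x0: "0 \<le> u x" using x by (intro nonneg) (auto simp: \<Omega>_def mem_Times_iff abs_le_iff)
  have x1: "1/16 \<le> weighted_sq 1 1 (m, n) x" using close[of x] uv v_less[of x] by linarith
  obtain g where g: "path g" "pathstart g = x"
    "\<And>y. y \<in> path_image g \<Longrightarrow> weighted_sq 1 1 (m, n) y < 400 \<and> 0 \<le> weighted_sq 1 1 (m, n) y - 1/16 \<and> u y < ?v y"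
    "weighted_sq 1 1 (m, n) (pathfinish g) - 1/16 = 0"
  proof (rule box_barrier_path[where A = 1 and B = 1 and k = k and c = 400 and p = "(m, n)"
        and \<kappa> = "\<lambda>x. weighted_sq 1 1 (m, n) x - 1/16" and z = x])
    fix y assume y: "weighted_sq 1 1 (m, n) y \<le> 400" "0 \<le> weighted_sq 1 1 (m, n) y - 1/16"
    have "(fst y - m)\<^sup>2 \<le> 20\<^sup>2" "(snd y - n)\<^sup>2 \<le> 20\<^sup>2"
      using y(1) weighted_sq_ge[of 1 1 y "(m, n)"] by auto
    then have "\<bar>fst y - m\<bar> \<le> 20" "\<bar>snd y - n\<bar> \<le> 20"
      using abs_le_square_iff[of "fst y - m" 20] abs_le_square_iff[of "snd y - n" 20] by auto
    then show "y \<in> \<Omega>" using mn by (auto simp: \<Omega>_def mem_Times_iff abs_le_iff)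
    show "1 / 10 ^ 8 \<le> (1 * (fst y - fst (m, n)))\<^sup>2 + (h (fst y) * 1 * (snd y - snd (m, n)))\<^sup>2"
    proof (cases "\<bar>fst y - m\<bar> \<le> 1/32")
      case True
      then have "(fst y - m)\<^sup>2 \<le> (1/32)\<^sup>2" by (simp add: abs_le_square_iff[symmetric])
      \<comment> \<open>Outside the inner disc the squared distance is at least 1/16, so a small
        horizontal part forces a large vertical one.\<close>
      then have "1/32 \<le> (snd y - n)\<^sup>2" using y(2) by (simp add: weighted_sq_def power_divide)
      then have "(1/32)\<^sup>2 * (1/32) \<le> (h (fst y))\<^sup>2 * (snd y - n)\<^sup>2"
        using h_near[OF mn(3) True] by (intro mult_mono) auto
      then show ?thesis
        by (intro add_increasing) (auto simp: power_mult_distrib power_divide)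
    next
      case False
      then have "(1/32)\<^sup>2 \<le> \<bar>fst y - m\<bar>\<^sup>2" by (intro power_mono) auto
      then show ?thesis
        by (intro add_increasing2) (auto simp: power_divide)
    qed
  qed (use k uv x0 x1 in \<open>auto intro!: continuous_intros\<close>)
  have "u (pathfinish g) < ?v (pathfinish g)" using g(3) by blast
  then show False using close[of "pathfinish g"] g(4) v_less[of "pathfinish g"] by simp
qed

text \<open>The maximum principle here needs strictness, so \<open>u\<close> is perturbed by a small
  multiple of the square of \<open>t\<close> before escaping from the box.\<close>

lemma superlevel_path:
  assumes z: "\<bar>fst z\<bar> \<le> 1" "\<bar>snd z\<bar> \<le> 1" and pos: "0 < u z"
  obtains f where "path f" "pathstart f = z"
    "\<And>x. x \<in> path_image f \<Longrightarrow> \<bar>fst x\<bar> \<le> 5 \<and> \<bar>snd x\<bar> \<le> 3 \<and> u z / 2 < u x"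
    "\<bar>fst (pathfinish f)\<bar> = 5 \<or> \<bar>snd (pathfinish f)\<bar> = 3"
proof -
  \<comment> \<open>On the box the perturbation is at most \<open>25 * e = u z / 4\<close>, so
    \<open>w > 0\<close> still gives \<open>u > u z / 2\<close>.\<close>
  define e where "e = u z / 100"
  \<comment> \<open>The quadratic term makes the solution a strict subsolution.\<close>
  define w where "w x = u x + (e * (fst x)\<^sup>2 - 3 * u z / 4)" for x
  let ?Q = "cbox (-5, -3) (5, 3) :: (real \<times> real) set"
  have e: "0 < e" using pos by (simp add: e_def)
  have Q\<Omega>: "?Q \<subseteq> \<Omega>" by (auto simp: \<Omega>_def cbox_Pair_eq)
  have big: "u z / 2 < u x" if "x \<in> ?Q" "0 < w x" for x
  proof -
    have "\<bar>fst x\<bar> \<le> 5" using that by (auto simp: cbox_Pair_eq abs_le_iff)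
    then have "(fst x)\<^sup>2 \<le> 5\<^sup>2" using abs_le_square_iff[of "fst x" 5] by simp
    then have "e * (fst x)\<^sup>2 \<le> e * 25" using e by (intro mult_left_mono) auto
    with that show ?thesis by (simp add: w_def e_def)
  qed
  have sub: "strict_subsol lam Lam h w x" if "x \<in> ?Q" for x
  proof -
    have "x \<in> \<Omega>" using that Q\<Omega> by auto
    then obtain a b c P S R where el: "elliptic lam Lam a b c"
      and eq: "a * P + 2 * b * h (fst x) * S + c * (h (fst x))\<^sup>2 * R = 0"
      and s: "\<And>\<xi>. second_along u x \<xi> (quad2 P S R \<xi>)"
      using sol unfolding grushin_sol_def by blast
    have "0 < a * (2 * e)" using ellipticD(2)[OF el] lam e by simp
    with eq have *: "0 < a * (P + 2 * e) + 2 * b * h (fst x) * S + c * (h (fst x))\<^sup>2 * R"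
      by (simp add: algebra_simps)
    have "second_along w x \<xi> (quad2 P S R \<xi> + quad2 (2 * e) 0 0 \<xi>)" for \<xi>
      unfolding w_def by (intro second_along_add s second_along_fst_square)
    moreover have "quad2 P S R \<xi> + quad2 (2 * e) 0 0 \<xi> = quad2 (P + 2 * e) S R \<xi>" for \<xi>
      by (simp add: quad2_def algebra_simps)
    ultimately show ?thesis
      unfolding strict_subsol_def using el * by (metis (no_types, lifting))
  qed
  have cont: "continuous_on \<Omega> w"
    using sol unfolding grushin_sol_def w_def by (intro continuous_intros) auto
  have op: "open \<Omega>" by (simp add: \<Omega>_def open_Times)
  have zQ: "z \<in> ?Q" using z by (cases z) (auto simp: cbox_Pair_eq abs_le_iff)
  have "3 * u z / 4 < u z" using pos by simp
  then have wz: "0 < w z" using e unfolding w_def by (smt (verit) zero_le_power2 mult_nonneg_nonneg)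
  obtain f where f: "path f" "pathstart f = z" "path_image f \<subseteq> ?Q \<inter> {x. 0 < w x}"
    "pathfinish f \<in> frontier ?Q"
    by (rule escape_path[OF lam(1) op cont _ Q\<Omega> zQ wz, where h = h and Lam = Lam]) (use sub in auto)
  show ?thesis
  proof (rule that[OF f(1,2)])
    fix x assume "x \<in> path_image f"
    then have "x \<in> ?Q" "0 < w x" using f(3) by auto
    with big show "\<bar>fst x\<bar> \<le> 5 \<and> \<bar>snd x\<bar> \<le> 3 \<and> u z / 2 < u x"
      by (cases x) (auto simp: cbox_Pair_eq abs_le_iff)
  next
    show "\<bar>fst (pathfinish f)\<bar> = 5 \<or> \<bar>snd (pathfinish f)\<bar> = 3"
      using f(4) unfolding frontier_cbox
      by (cases "pathfinish f") (auto simp: cbox_Pair_eq box_prod)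
  qed
qed

text \<open>The side through which the superlevel path exits determines a strip between it and the
  unit square. The crossing bound and \<open>spread\<close> each contribute one exponential
  factor.\<close>

lemma harnack_box:
  assumes z: "\<bar>fst z\<bar> \<le> 1" "\<bar>snd z\<bar> \<le> 1" and x: "\<bar>fst x\<bar> \<le> 1" "\<bar>snd x\<bar> \<le> 1"
  shows "u z / 2 * (exp (- \<alpha> * (3/4)) - exp (- \<alpha>)) * (exp (- \<alpha> * 200) - exp (- \<alpha> * 400)) \<le> u x"
proof (cases "u z = 0")
  case True
  have "0 \<le> u x" using x by (intro nonneg) (auto simp: \<Omega>_def mem_Times_iff abs_le_iff)
  with True show ?thesis by simp
next
  case False
  define k where "k = u z / 2"
  have "0 \<le> u z" using z by (intro nonneg) (auto simp: \<Omega>_def mem_Times_iff abs_le_iff)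
  with False have pos: "0 < u z" by simp
  then have k: "0 < k" by (simp add: k_def)
  let ?c = "exp (- \<alpha> * (3/4)) - exp (- \<alpha>)"
  have c: "0 < ?c" using alpha_pos by simp
  obtain f where f: "path f" "pathstart f = z"
    "\<And>x. x \<in> path_image f \<Longrightarrow> \<bar>fst x\<bar> \<le> 5 \<and> \<bar>snd x\<bar> \<le> 3 \<and> k < u x"
    "\<bar>fst (pathfinish f)\<bar> = 5 \<or> \<bar>snd (pathfinish f)\<bar> = 3"
    using superlevel_path[OF z pos] unfolding k_def by metis
  note r = path_image_reversepath pathstart_reversepath pathfinish_reversepath
  obtain m n where mn: "\<bar>m\<bar> \<le> 9" "\<bar>n\<bar> \<le> 5" "1/16 \<le> \<bar>h m\<bar>"
    "\<And>y. \<bar>fst y - m\<bar> \<le> 1/4 \<Longrightarrow> \<bar>snd y - n\<bar> \<le> 1/4 \<Longrightarrow> k * ?c \<le> u y"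
  proof -
    consider "fst (pathfinish f) = 5" | "fst (pathfinish f) = -5"
      | "snd (pathfinish f) = 3" | "snd (pathfinish f) = -3"
      using f(4) by linarith
    then show ?thesis
    proof cases
      case 1
      \<comment> \<open>The strips of half-width 1 about 2 and 4 both lie between the unit square
        and the side \<open>t = 5\<close>.\<close>
      obtain m where m: "m = 2 \<or> m = 4" "1/16 \<le> \<bar>h m\<bar>"
        using h_nondegenerate[of 2 4] by auto
      show ?thesis
        by (rule that[of m 5]; (rule horizontal_crossing[of f m])?) (use m 1 f z k in auto)
    next
      case 2
      obtain m where m: "m = -2 \<or> m = -4" "1/16 \<le> \<bar>h m\<bar>"
        using h_nondegenerate[of "-2" "-4"] by auto
      show ?thesis
        by (rule that[of m 5]; (rule horizontal_crossing[of "reversepath f" m])?)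
           (use m 2 f z k in \<open>auto simp: r\<close>)
    next
      case 3
      \<comment> \<open>Here \<open>m\<close> only places the target square beyond the path;
        \<open>h m\<close> must be nonzero for \<open>spread\<close>.\<close>
      obtain m where m: "m = 7 \<or> m = 9" "1/16 \<le> \<bar>h m\<bar>"
        using h_nondegenerate[of 7 9] by auto
      show ?thesis
        by (rule that[of m 2]; (rule vertical_crossing[of f 2 k m])?) (use m 3 f z k in auto)
    next
      case 4
      obtain m where m: "m = 7 \<or> m = 9" "1/16 \<le> \<bar>h m\<bar>"
        using h_nondegenerate[of 7 9] by auto
      show ?thesis
        by (rule that[of m "-2"]; (rule vertical_crossing[of "reversepath f" "-2" k m])?)
           (use m 4 f z k in \<open>auto simp: r\<close>)
    qed
  qed
  show ?thesis
    using spread[OF mn(1-3) _ mn(4) x] k c unfolding k_def by simp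
qed

end

subsection \<open>Twice continuously differentiable functions\<close>

text \<open>The mean value theorem is applied in \<open>s\<close> and then in \<open>t\<close>;
  using both orders yields the symmetry of mixed partials.\<close>

lemma second_mixed_difference:
  fixes f :: "real \<times> real \<Rightarrow> real"
  assumes h: "0 < h"
    and box: "\<And>s t. s \<in> {a..a+h} \<Longrightarrow> t \<in> {b..b+h} \<Longrightarrow> (s, t) \<in> S"
    and f1: "\<And>s t. (s, t) \<in> S \<Longrightarrow> ((\<lambda>s. f (s, t)) has_real_derivative f1 (s, t)) (at s)"
    and f12: "\<And>s t. (s, t) \<in> S \<Longrightarrow> ((\<lambda>t. f1 (s, t)) has_real_derivative f12 (s, t)) (at t)"
  obtains s t where "s \<in> {a..a+h}" "t \<in> {b..b+h}"
    "f (a+h, b+h) - f (a+h, b) - f (a, b+h) + f (a, b) = h * h * f12 (s, t)"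
proof -
  have "\<exists>s>a. s < a + h \<and> (f (a+h, b+h) - f (a+h, b)) - (f (a, b+h) - f (a, b)) =
      (a + h - a) * (f1 (s, b+h) - f1 (s, b))"
    by (rule MVT2) (use h in \<open>auto intro!: DERIV_diff f1 box\<close>)
  then obtain s where s: "a < s" "s < a + h"
    "(f (a+h, b+h) - f (a+h, b)) - (f (a, b+h) - f (a, b)) = h * (f1 (s, b+h) - f1 (s, b))"
    by auto
  have "\<exists>t>b. t < b + h \<and> f1 (s, b+h) - f1 (s, b) = (b + h - b) * f12 (s, t)"
    by (rule MVT2) (use h s in \<open>auto intro!: f12 box\<close>)
  then obtain t where t: "b < t" "t < b + h" "f1 (s, b+h) - f1 (s, b) = h * f12 (s, t)"
    by auto
  show ?thesis using s t by (intro that[of s t]) (auto simp: algebra_simps)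
qed

lemma C1_on_partials:
  assumes "C1_on S f" "x \<in> S"
  shows "((\<lambda>s. f (s, snd x)) has_real_derivative partial1 f x) (at (fst x))"
    "((\<lambda>t. f (fst x, t)) has_real_derivative partial2 f x) (at (snd x))"
  using assms by (auto simp: C1_on_def partial1_def partial2_def DERIV_deriv_iff_field_differentiable)

lemma C1_on_has_derivative:
  assumes S: "open S" and f: "C1_on S f" and x: "x \<in> S"
  shows "(f has_derivative (\<lambda>\<xi>. partial1 f x * fst \<xi> + partial2 f x * snd \<xi>)) (at x)"
proof -
  obtain A B where AB: "open A" "open B" "x \<in> A \<times> B" "A \<times> B \<subseteq> S"
    using S x by (metis open_prod_elim)
  then obtain e where e: "e > 0" "ball (snd x) e \<subseteq> B"
    by (metis mem_Times_iff open_contains_ball)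
  \<comment> \<open>A ball, because \<open>has_derivative_partialsI\<close> asks for a convex second
    factor.\<close>
  let ?Y = "ball (snd x) e"
  have sub: "A \<times> ?Y \<subseteq> S" using AB e by auto
  have xin: "(fst x, snd x) \<in> A \<times> ?Y" using AB e by auto
  have o: "open (A \<times> ?Y)" using AB by (intro open_Times) auto
  have "((\<lambda>(s, t). f (s, t)) has_derivative
      (\<lambda>(tx, ty). partial1 f x * tx + blinfun_mult_right (partial2 f (fst x, snd x)) ty))
      (at (fst x, snd x) within A \<times> ?Y)"
  proof (rule has_derivative_partialsI)
    show "((\<lambda>s. f (s, snd x)) has_derivative (*) (partial1 f x)) (at (fst x) within A)"
      using C1_on_partials(1)[OF f x] by (simp add: has_field_derivative_def has_derivative_at_withinI)
    show "((\<lambda>t. f (s, t)) has_derivative blinfun_apply (blinfun_mult_right (partial2 f (s, t))))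
      (at t within ?Y)" if "s \<in> A" "t \<in> ?Y" for s t
    proof -
      have "(s, t) \<in> S" using that sub by auto
      from C1_on_partials(2)[OF f this] show ?thesis
        by (simp add: has_field_derivative_def has_derivative_at_withinI blinfun_mult_right.rep_eq)
    qed
    have "continuous_on (A \<times> ?Y) (partial2 f)"
      using f sub continuous_on_subset by (auto simp: C1_on_def)
    then have "continuous (at (fst x, snd x) within A \<times> ?Y) (partial2 f)"
      using xin unfolding continuous_on_eq_continuous_within by blast
    then show "continuous (at (fst x, snd x) within A \<times> ?Y)
      (\<lambda>(s, t). blinfun_mult_right (partial2 f (s, t)))"
      unfolding continuous_within case_prod_beta
      by (auto intro!: bounded_linear.tendsto[OF bounded_linear_blinfun_mult_right])
  qed (use e in auto)
  then show ?thesis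
    using at_within_open[OF xin o] by (simp add: case_prod_beta' blinfun_mult_right.rep_eq)
qed

lemma C1_on_imp_continuous_on:
  assumes "open S" "C1_on S f"
  shows "continuous_on S f"
  using C1_on_has_derivative[OF assms] has_derivative_continuous continuous_at_imp_continuous_on by blast

text \<open>The same second difference over a small square equals either mixed partial at some
  nearby point, up to the same factor, and both are continuous.\<close>

lemma mixed_partials_eq:
  assumes S: "open S" and u: "C2_on S u" and x: "x \<in> S"
  shows "partial2 (partial1 u) x = partial1 (partial2 u) x"
proof (rule ccontr)
  assume ne: "partial2 (partial1 u) x \<noteq> partial1 (partial2 u) x"
  have C: "C1_on S u" "C1_on S (partial1 u)" "C1_on S (partial2 u)"
    using u by (auto simp: C2_on_def)
  define e where "e = \<bar>partial2 (partial1 u) x - partial1 (partial2 u) x\<bar> / 2"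
  have e: "0 < e" using ne by (simp add: e_def)
  have "isCont (partial2 (partial1 u)) x" "isCont (partial1 (partial2 u)) x"
    using C S x by (auto simp: C1_on_def continuous_on_eq_continuous_at)
  then have "\<forall>\<^sub>F z in nhds x. dist (partial2 (partial1 u) z) (partial2 (partial1 u) x) < e"
    "\<forall>\<^sub>F z in nhds x. dist (partial1 (partial2 u) z) (partial1 (partial2 u) x) < e"
    using e tendstoD unfolding isCont_def tendsto_at_iff_tendsto_nhds by blast+
  moreover have "\<forall>\<^sub>F z in nhds x. z \<in> S" using S x by (rule eventually_nhds_in_open)
  ultimately have "\<forall>\<^sub>F z in nhds x. z \<in> S \<and>
      dist (partial2 (partial1 u) z) (partial2 (partial1 u) x) < e \<and>
      dist (partial1 (partial2 u) z) (partial1 (partial2 u) x) < e"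
    by eventually_elim simp
  then obtain d where d: "d > 0" and near: "\<And>z. dist z x < d \<Longrightarrow> z \<in> S \<and>
      dist (partial2 (partial1 u) z) (partial2 (partial1 u) x) < e \<and>
      dist (partial1 (partial2 u) z) (partial1 (partial2 u) x) < e"
    by (auto simp: eventually_nhds_metric)
  define h where "h = d / 3"
  have h: "0 < h" using d by (simp add: h_def)
  obtain a b where ab: "x = (a, b)" by (cases x)
  have inside: "dist (s, t) x < d" if "s \<in> {a..a+h}" "t \<in> {b..b+h}" for s t
  proof -
    have "dist (s, t) x \<le> dist s a + dist t b"
      unfolding ab dist_prod_def by (simp add: sqrt_sum_squares_le_sum)
    also have "\<dots> < d" using that d by (auto simp: dist_real_def h_def)
    finally show ?thesis .
  qed
  have box: "(s, t) \<in> S" if "s \<in> {a..a+h}" "t \<in> {b..b+h}" for s t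
    using near[OF inside[OF that]] by blast
  obtain s t where st: "s \<in> {a..a+h}" "t \<in> {b..b+h}"
    "u (a+h, b+h) - u (a+h, b) - u (a, b+h) + u (a, b) = h * h * partial2 (partial1 u) (s, t)"
  proof (rule second_mixed_difference[OF h, of a b S u "partial1 u" "partial2 (partial1 u)"])
    show "((\<lambda>s. u (s, t)) has_real_derivative partial1 u (s, t)) (at s)" if "(s, t) \<in> S" for s t
      using C1_on_partials(1)[OF C(1) that] by simp
    show "((\<lambda>t. partial1 u (s, t)) has_real_derivative partial2 (partial1 u) (s, t)) (at t)"
      if "(s, t) \<in> S" for s t
      using C1_on_partials(2)[OF C(2) that] by simp
  qed (use box in auto)
  \<comment> \<open>The other order of differentiation is obtained by swapping the
    coordinates.\<close>
  obtain t' s' where st': "t' \<in> {b..b+h}" "s' \<in> {a..a+h}"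
    "u (a+h, b+h) - u (a, b+h) - u (a+h, b) + u (a, b) = h * h * partial1 (partial2 u) (s', t')"
  proof (rule second_mixed_difference[OF h, of b a "{(t, s). (s, t) \<in> S}" "\<lambda>(t, s). u (s, t)"
        "\<lambda>(t, s). partial2 u (s, t)" "\<lambda>(t, s). partial1 (partial2 u) (s, t)"])
    show "((\<lambda>t. (\<lambda>(t, s). u (s, t)) (t, s)) has_real_derivative (\<lambda>(t, s). partial2 u (s, t)) (t, s)) (at t)"
      if "(t, s) \<in> {(t, s). (s, t) \<in> S}" for s t
      using C1_on_partials(2)[OF C(1), of "(s, t)"] that by simp
    show "((\<lambda>s. (\<lambda>(t, s). partial2 u (s, t)) (t, s)) has_real_derivative
        (\<lambda>(t, s). partial1 (partial2 u) (s, t)) (t, s)) (at s)"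
      if "(t, s) \<in> {(t, s). (s, t) \<in> S}" for s t
      using C1_on_partials(1)[OF C(3), of "(s, t)"] that by simp
  qed (use box in auto)
  have "partial2 (partial1 u) (s, t) = partial1 (partial2 u) (s', t')"
    proof -
    have "h * h * partial2 (partial1 u) (s, t) = h * h * partial1 (partial2 u) (s', t')"
      using st(3) st'(3) by linarith
    then show ?thesis using h by simp
  qed
  moreover have "dist (partial2 (partial1 u) (s, t)) (partial2 (partial1 u) x) < e"
    "dist (partial1 (partial2 u) (s', t')) (partial1 (partial2 u) x) < e"
    using near[OF inside] st st' by auto
  ultimately show False unfolding e_def dist_real_def by argo
qed

lemma C2_on_second_along:
  assumes S: "open S" and u: "C2_on S u" and x: "x \<in> S"
  shows "second_along u x \<xi>
    (quad2 (partial1 (partial1 u) x) (partial2 (partial1 u) x) (partial2 (partial2 u) x) \<xi>)"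
proof -
  have C: "C1_on S u" "C1_on S (partial1 u)" "C1_on S (partial2 u)"
    using u by (auto simp: C2_on_def)
  have line: "((\<lambda>\<tau>. f (x + \<tau> *\<^sub>R \<xi>)) has_real_derivative
      partial1 f (x + \<tau> *\<^sub>R \<xi>) * fst \<xi> + partial2 f (x + \<tau> *\<^sub>R \<xi>) * snd \<xi>) (at \<tau>)"
    if "C1_on S f" "x + \<tau> *\<^sub>R \<xi> \<in> S" for f \<tau>
  proof -
    have "((\<lambda>\<tau>. x + \<tau> *\<^sub>R \<xi>) has_derivative (\<lambda>\<tau>. \<tau> *\<^sub>R \<xi>)) (at \<tau>)"
      by (auto intro!: derivative_eq_intros)
    from has_derivative_compose[OF this C1_on_has_derivative[OF S that]]
    show ?thesis unfolding has_field_derivative_def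
      by (rule has_derivative_eq_rhs) (auto simp: algebra_simps)
  qed
  have "filterlim (\<lambda>\<tau>. x + \<tau> *\<^sub>R \<xi>) (nhds (x + 0 *\<^sub>R \<xi>)) (nhds 0)"
    by (intro tendsto_intros filterlim_ident)
  then have "\<forall>\<^sub>F \<tau> in nhds 0. x + \<tau> *\<^sub>R \<xi> \<in> S"
    using eventually_compose_filterlim[OF eventually_nhds_in_open[OF S x]] by simp
  then have 1: "\<forall>\<^sub>F \<tau> in nhds 0. ((\<lambda>\<tau>. u (x + \<tau> *\<^sub>R \<xi>)) has_real_derivative
      partial1 u (x + \<tau> *\<^sub>R \<xi>) * fst \<xi> + partial2 u (x + \<tau> *\<^sub>R \<xi>) * snd \<xi>) (at \<tau>)"
    by eventually_elim (rule line[OF C(1)])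
  have 2: "((\<lambda>\<tau>. partial1 u (x + \<tau> *\<^sub>R \<xi>) * fst \<xi> + partial2 u (x + \<tau> *\<^sub>R \<xi>) * snd \<xi>)
      has_real_derivative quad2 (partial1 (partial1 u) x) (partial2 (partial1 u) x)
        (partial2 (partial2 u) x) \<xi>) (at 0)"
    by (rule DERIV_cong[OF DERIV_add[OF DERIV_cmult_right[OF line] DERIV_cmult_right[OF line]]])
       (use C x in \<open>auto simp: quad2_def power2_eq_square algebra_simps
          mixed_partials_eq[OF S u x, symmetric]\<close>)
  show ?thesis unfolding second_along_def by (intro exI conjI, rule 1, rule 2)
qed

subsection \<open>Grushin balls\<close>

lemma elliptic_of_ellipticity_constants:
  "ellipticity_constants lam Lam a11 a12 a22 \<Longrightarrow> elliptic lam Lam (a11 x) (a12 x) (a22 x)"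
  unfolding ellipticity_constants_def elliptic_def by blast

text \<open>The weight \<open>fst x\<close> is constant in the second variable, so squaring the
  second field creates no first-order term.\<close>

lemma grushin_L_eq:
  assumes "C2_on S u" "x \<in> S"
  shows "grushin_L a11 a12 a22 u x = a11 x * partial1 (partial1 u) x
    + 2 * a12 x * fst x * partial2 (partial1 u) x + a22 x * (fst x)\<^sup>2 * partial2 (partial2 u) x"
proof -
  have 1: "grushin_X1 u = partial1 u" by (rule ext) (simp add: grushin_X1_def)
  have "(\<lambda>t. partial2 u (fst x, t)) field_differentiable at (snd x)"
    using assms by (auto simp: C2_on_def C1_on_def)
  then have "partial2 (grushin_X2 u) x = fst x * partial2 (partial2 u) x"
    by (simp add: partial2_def[of "grushin_X2 u"] partial2_def[of "partial2 u"] grushin_X2_def)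
  then show ?thesis
    by (simp add: grushin_L_def 1 grushin_X1_def[of "partial1 u"] grushin_X2_def[of "partial1 u"]
        grushin_X2_def[of "grushin_X2 u"] power2_eq_square)
qed

lemma open_grushin_ball: "open (grushin_ball y r)"
  unfolding grushin_ball_def grushin_dist_def by (intro open_Collect_less continuous_intros)

text \<open>Moving \<open>sqrt ?X\<close> to the other side and squaring bounds
  \<open>4 * ?s\<close> by \<open>r^2 + 2 * r * sqrt ?X\<close>, where
  \<open>sqrt ?X \<le> 2 * \<bar>fst y\<bar> + r\<close>.\<close>

lemma grushin_ball_subset_rectangle:
  assumes "0 < r" and x: "x \<in> grushin_ball y r"
  shows "\<bar>fst x - fst y\<bar> \<le> r" "\<bar>snd x - snd y\<bar> \<le> r * (\<bar>fst y\<bar> + r)"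
proof -
  let ?X = "(fst x)\<^sup>2 + (fst y)\<^sup>2" and ?s = "\<bar>snd x - snd y\<bar>"
  have lt: "\<bar>fst x - fst y\<bar> + sqrt (?X + 4 * ?s) - sqrt ?X < r"
    using x by (simp add: grushin_ball_def grushin_dist_def)
  have "sqrt ?X \<le> sqrt (?X + 4 * ?s)" by (intro real_sqrt_le_mono) simp
  with lt show 1: "\<bar>fst x - fst y\<bar> \<le> r" by linarith
  have X: "sqrt ?X \<le> \<bar>fst x\<bar> + \<bar>fst y\<bar>"
    using sqrt_sum_squares_le_sum_abs by blast
  then have "sqrt ?X \<le> 2 * \<bar>fst y\<bar> + r" using 1 by linarith
  then have "2 * r * sqrt ?X \<le> 2 * r * (2 * \<bar>fst y\<bar> + r)"
    using assms(1) by (intro mult_left_mono) auto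
  moreover have "(sqrt (?X + 4 * ?s))\<^sup>2 \<le> (r + sqrt ?X)\<^sup>2"
    using lt by (intro power_mono) auto
  then have "4 * ?s \<le> r\<^sup>2 + 2 * r * sqrt ?X"
    by (simp add: power2_sum)
  ultimately have "4 * ?s \<le> 3 * (r * r) + 4 * (r * \<bar>fst y\<bar>)"
    by (simp add: power2_eq_square algebra_simps)
  moreover have "a \<le> b + c" if "4 * a \<le> 3 * b + 4 * c" "0 \<le> b" for a b c :: real
    using that by linarith
  ultimately have "?s \<le> r * r + r * \<bar>fst y\<bar>" using zero_le_square[of r] by blast
  then show "?s \<le> r * (\<bar>fst y\<bar> + r)"
    by (simp add: power2_eq_square algebra_simps)
qed

lemma rectangle_subset_grushin_ball:
  assumes r: "0 < r" and x: "\<bar>fst x - fst y\<bar> < 30 * r" "\<bar>snd x - snd y\<bar> < 30 * r * (\<bar>fst y\<bar> + r)"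
  shows "x \<in> grushin_ball y (100 * r)"
proof -
  let ?X = "(fst x)\<^sup>2 + (fst y)\<^sup>2" and ?s = "\<bar>snd x - snd y\<bar>"
  have "\<bar>fst y\<bar> \<le> sqrt ?X" by (rule real_le_rsqrt) simp
  then have "r * \<bar>fst y\<bar> \<le> r * sqrt ?X"
    using r by (intro mult_left_mono) auto
  moreover have "4 * ?s \<le> 120 * (r * \<bar>fst y\<bar>) + 120 * (r * r)"
    using x(2) by (simp add: algebra_simps)
  moreover have "0 \<le> r * \<bar>fst y\<bar>" "0 \<le> r * r" using r by auto
  \<comment> \<open>The coefficients 120 are enlarged to 140 and 4900 to complete a square; the
    radius factor 100 is 30 + 70.\<close>
  ultimately have "?X + 4 * ?s \<le> ?X + 140 * (r * sqrt ?X) + 4900 * (r * r)"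
    by linarith
  also have "\<dots> = (sqrt ?X + 70 * r)\<^sup>2"
    by (simp add: power2_sum power_mult_distrib power2_eq_square[of r])
  finally have "sqrt (?X + 4 * ?s) \<le> sqrt ?X + 70 * r"
    using r by (intro real_le_lsqrt) auto
  with x(1) show ?thesis by (simp add: grushin_ball_def grushin_dist_def)
qed

lemma harnack_grushin_ball:
  fixes lam Lam r :: real and u :: "real \<times> real \<Rightarrow> real"
  defines "\<alpha> \<equiv> 10 ^ 12 * Lam / lam"
  assumes lam: "0 < lam" "lam \<le> Lam" and r: "0 < r"
    and ell: "ellipticity_constants lam Lam a11 a12 a22"
    and C2: "C2_on (grushin_ball y (100 * r)) u"
    and L: "\<And>x. x \<in> grushin_ball y (100 * r) \<Longrightarrow> grushin_L a11 a12 a22 u x = 0"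
    and nn: "\<And>x. x \<in> grushin_ball y (100 * r) \<Longrightarrow> 0 \<le> u x"
    and x: "x \<in> grushin_ball y r" and z: "z \<in> grushin_ball y r"
  shows "u z / 2 * (exp (- \<alpha> * (3/4)) - exp (- \<alpha>)) * (exp (- \<alpha> * 200) - exp (- \<alpha> * 400)) \<le> u x"
proof -
  let ?B = "grushin_ball y (100 * r)"
  \<comment> \<open>The size of the first coordinate on the ball, so \<open>r * \<sigma>\<close> is
    its vertical scale and \<open>\<bar>fst y\<bar> / \<sigma> + r / \<sigma> = 1\<close>.\<close>
  define \<sigma> where "\<sigma> = \<bar>fst y\<bar> + r"
  have \<sigma>: "0 < \<sigma>" using r by (simp add: \<sigma>_def add_nonneg_pos)
  define \<Phi> where "\<Phi> q = (fst y + r * fst q, snd y + r * \<sigma> * snd q)" for q :: "real \<times> real"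
  let ?\<Omega> = "{-30<..<30} \<times> {-30<..<30} :: (real \<times> real) set"
  have in_ball: "\<Phi> q \<in> ?B" if "q \<in> ?\<Omega>" for q
  proof (rule rectangle_subset_grushin_ball[OF r])
    have q: "\<bar>fst q\<bar> < 30" "\<bar>snd q\<bar> < 30" using that by (auto simp: mem_Times_iff)
    then show "\<bar>fst (\<Phi> q) - fst y\<bar> < 30 * r" using r by (simp add: \<Phi>_def abs_mult)
    have "(r * \<sigma>) * \<bar>snd q\<bar> < (r * \<sigma>) * 30" using q r \<sigma> by (intro mult_strict_left_mono) auto
    moreover have "\<bar>snd (\<Phi> q) - snd y\<bar> = (r * \<sigma>) * \<bar>snd q\<bar>"
      using r \<sigma> by (simp add: \<Phi>_def abs_mult)
    ultimately show "\<bar>snd (\<Phi> q) - snd y\<bar> < 30 * r * (\<bar>fst y\<bar> + r)"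
      by (simp add: \<sigma>_def mult_ac)
  qed
  have sol: "grushin_sol lam Lam (\<lambda>t. fst y / \<sigma> + r / \<sigma> * t) ?\<Omega> (\<lambda>q. u (\<Phi> q))"
    unfolding grushin_sol_def
  proof (intro conjI ballI)
    have "continuous_on ?B u"
      using C2 C1_on_imp_continuous_on[OF open_grushin_ball] by (auto simp: C2_on_def)
    moreover have "continuous_on ?\<Omega> \<Phi>" unfolding \<Phi>_def by (intro continuous_intros)
    ultimately show "continuous_on ?\<Omega> (\<lambda>q. u (\<Phi> q))"
      using in_ball by (auto intro: continuous_on_compose2)
  next
    fix q assume q: "q \<in> ?\<Omega>"
    show "0 \<le> u (\<Phi> q)" using nn in_ball[OF q] by blast
    let ?x = "\<Phi> q"
    let ?P = "partial1 (partial1 u) ?x" and ?S = "partial2 (partial1 u) ?x"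
      and ?R = "partial2 (partial2 u) ?x"
    show "\<exists>a b c P Q R. elliptic lam Lam a b c \<and>
      a * P + 2 * b * (fst y / \<sigma> + r / \<sigma> * fst q) * Q + c * (fst y / \<sigma> + r / \<sigma> * fst q)\<^sup>2 * R = 0 \<and>
      (\<forall>\<xi>. second_along (\<lambda>q. u (\<Phi> q)) q \<xi> (quad2 P Q R \<xi>))"
    proof (intro exI conjI allI)
      show "elliptic lam Lam (a11 ?x) (a12 ?x) (a22 ?x)"
        by (rule elliptic_of_ellipticity_constants[OF ell])
      have h: "fst y / \<sigma> + r / \<sigma> * fst q = fst ?x / \<sigma>"
        using \<sigma> by (simp add: \<Phi>_def field_simps)
      \<comment> \<open>The powers of \<open>\<sigma>\<close> from the rescaled Hessian cancel
        against \<open>h = fst ?x / \<sigma>\<close>.\<close>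
      have "a11 ?x * (r\<^sup>2 * ?P) + 2 * a12 ?x * (fst ?x / \<sigma>) * (r\<^sup>2 * \<sigma> * ?S)
          + a22 ?x * (fst ?x / \<sigma>)\<^sup>2 * (r\<^sup>2 * \<sigma>\<^sup>2 * ?R) = r\<^sup>2 * grushin_L a11 a12 a22 u ?x"
        using \<sigma> by (simp add: grushin_L_eq[OF C2 in_ball[OF q]] power2_eq_square field_simps)
      then show "a11 ?x * (r\<^sup>2 * ?P) + 2 * a12 ?x * (fst y / \<sigma> + r / \<sigma> * fst q) * (r\<^sup>2 * \<sigma> * ?S)
          + a22 ?x * (fst y / \<sigma> + r / \<sigma> * fst q)\<^sup>2 * (r\<^sup>2 * \<sigma>\<^sup>2 * ?R) = 0"
        unfolding h using L[OF in_ball[OF q]] by simp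
      fix \<xi> :: "real \<times> real"
      let ?\<zeta> = "(r * fst \<xi>, r * \<sigma> * snd \<xi>)"
      have "\<Phi> (q + \<tau> *\<^sub>R \<xi>) = ?x + \<tau> *\<^sub>R ?\<zeta>" for \<tau>
        by (simp add: \<Phi>_def algebra_simps)
      moreover have "second_along u ?x ?\<zeta> (quad2 ?P ?S ?R ?\<zeta>)"
        by (rule C2_on_second_along[OF open_grushin_ball C2 in_ball[OF q]])
      ultimately have "second_along (\<lambda>q. u (\<Phi> q)) q \<xi> (quad2 ?P ?S ?R ?\<zeta>)"
        by (simp add: second_along_def)
      moreover have "quad2 ?P ?S ?R ?\<zeta> = quad2 (r\<^sup>2 * ?P) (r\<^sup>2 * \<sigma> * ?S) (r\<^sup>2 * \<sigma>\<^sup>2 * ?R) \<xi>"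
        by (simp add: quad2_def power2_eq_square algebra_simps)
      ultimately show "second_along (\<lambda>q. u (\<Phi> q)) q \<xi>
          (quad2 (r\<^sup>2 * ?P) (r\<^sup>2 * \<sigma> * ?S) (r\<^sup>2 * \<sigma>\<^sup>2 * ?R) \<xi>)" by simp
    qed
  qed
  interpret grushin_box lam Lam "fst y / \<sigma>" "r / \<sigma>" "\<lambda>q. u (\<Phi> q)" "\<lambda>t. fst y / \<sigma> + r / \<sigma> * t" \<alpha> ?\<Omega>
    by unfold_locales
      (use lam r \<sigma> sol in \<open>auto simp: \<alpha>_def \<sigma>_def abs_divide add_divide_distrib[symmetric]\<close>)
  define \<Psi> where "\<Psi> x = ((fst x - fst y) / r, (snd x - snd y) / (r * \<sigma>))" for x :: "real \<times> real"
  have \<Phi>\<Psi>: "\<Phi> (\<Psi> x) = x" for x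
    using r \<sigma> by (simp add: \<Phi>_def \<Psi>_def)
  have unit: "\<bar>fst (\<Psi> x)\<bar> \<le> 1" "\<bar>snd (\<Psi> x)\<bar> \<le> 1" if "x \<in> grushin_ball y r" for x
    using grushin_ball_subset_rectangle[OF r that] r \<sigma>
    by (simp_all add: \<Psi>_def abs_divide abs_mult \<sigma>_def[symmetric])
  show ?thesis
    using harnack_box[OF unit[OF z] unit[OF x]] by (simp add: \<Phi>\<Psi>)
qed

theorem theorem6p9:
  fixes lam Lam :: real
  assumes "0 < lam" and "lam \<le> Lam"
  shows "\<exists>C \<eta> :: real. C > 1 \<and> \<eta> > 1 \<and>
    (\<forall>(a11 :: real \<times> real \<Rightarrow> real) (a12 :: real \<times> real \<Rightarrow> real) (a22 :: real \<times> real \<Rightarrow> real)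
       (y :: real \<times> real) (r :: real) (u :: real \<times> real \<Rightarrow> real).
       a11 \<in> borel_measurable lebesgue \<longrightarrow>
       a12 \<in> borel_measurable lebesgue \<longrightarrow>
       a22 \<in> borel_measurable lebesgue \<longrightarrow>
       ellipticity_constants lam Lam a11 a12 a22 \<longrightarrow>
       r > 0 \<longrightarrow>
       C2_on (grushin_ball y (\<eta> * r)) u \<longrightarrow>
       continuous_on (closure (grushin_ball y (\<eta> * r))) u \<longrightarrow>
       (\<forall>x\<in>grushin_ball y (\<eta> * r). grushin_L a11 a12 a22 u x = 0) \<longrightarrow>
       (\<forall>x\<in>grushin_ball y (\<eta> * r). u x \<ge> 0) \<longrightarrow>
       (SUP x\<in>grushin_ball y r. u x) \<le> C * (INF x\<in>grushin_ball y r. u x))"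
proof -
  define \<alpha> where "\<alpha> = 10 ^ 12 * Lam / lam"
  have \<alpha>: "0 < \<alpha>" using assms by (simp add: \<alpha>_def)
  define c where "c = (exp (- \<alpha> * (3/4)) - exp (- \<alpha>)) * (exp (- \<alpha> * 200) - exp (- \<alpha> * 400)) / 2"
  have d: "0 < exp (- \<alpha> * (3/4)) - exp (- \<alpha>)" "0 < exp (- \<alpha> * 200) - exp (- \<alpha> * 400)"
    using \<alpha> by simp_all
  then have c0: "0 < c" by (simp add: c_def)
  have "exp (- \<alpha> * (3/4)) - exp (- \<alpha>) \<le> 1" "exp (- \<alpha> * 200) - exp (- \<alpha> * 400) \<le> 1"
    using \<alpha> exp_le_one_iff[of "- \<alpha> * (3/4)"] exp_le_one_iff[of "- \<alpha> * 200"]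
      exp_ge_zero[of "- \<alpha>"] exp_ge_zero[of "- \<alpha> * 400"] by linarith+
  then have "(exp (- \<alpha> * (3/4)) - exp (- \<alpha>)) * (exp (- \<alpha> * 200) - exp (- \<alpha> * 400)) \<le> 1 * 1"
    using d by (intro mult_mono) auto
  then have c1: "c < 1" by (simp add: c_def)
  have bound: "(SUP x\<in>grushin_ball y r. u x) \<le> 1 / c * (INF x\<in>grushin_ball y r. u x)"
    if ell: "ellipticity_constants lam Lam a11 a12 a22" and r: "r > 0"
      and C2: "C2_on (grushin_ball y (100 * r)) u"
      and L: "\<And>x. x \<in> grushin_ball y (100 * r) \<Longrightarrow> grushin_L a11 a12 a22 u x = 0"
      and nn: "\<And>x. x \<in> grushin_ball y (100 * r) \<Longrightarrow> 0 \<le> u x"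
    for a11 a12 a22 y r u
  \<comment> \<open>Supremum and infimum are reached through pointwise inequalities over a nonempty
    ball, which also avoids a separate boundedness argument.\<close>
  proof (rule cSUP_least)
    have "y \<in> grushin_ball y r" using r by (simp add: grushin_ball_def grushin_dist_def)
    then show ne: "grushin_ball y r \<noteq> {}" by auto
    fix z assume z: "z \<in> grushin_ball y r"
    have "c * u z \<le> (INF x\<in>grushin_ball y r. u x)"
    proof (rule cINF_greatest[OF ne])
      fix x assume "x \<in> grushin_ball y r"
      from harnack_grushin_ball[OF assms r ell C2 L nn this z]
      show "c * u z \<le> u x" by (simp add: c_def \<alpha>_def mult_ac)
    qed
    then show "u z \<le> 1 / c * (INF x\<in>grushin_ball y r. u x)"
      using c0 by (simp add: field_simps)
  qed
  show ?thesis
    by (rule exI[of _ "1 / c"], rule exI[of _ 100]) (use c0 c1 bound in auto)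
qed

end
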